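(* Let $l\in\mathbb{Z}$ and $\alpha\in\{0,1,2,3\}$ with $l\equiv\alpha+1\pmod2$. Then the polynomial $D(l,0,\alpha;p)$ divides the polynomial $C(l,0,\alpha;p)$ in $\mathbb{Q}[p]$.
   Context: The Aztec diamond of size $n\ge1$ is the union of all unit squares $[i,i+1]\times[j,j+1]$ ($i,j\in\mathbb{Z}$) contained in $\{(x,y): |x|+|y|\le n+1\}$. Its squares are coloured black and white like a chessboard so that the left one of the two topmost squares is black. $\mathbb{P}(l,m;n)$ denotes the probability that a uniformly random domino tiling of the Aztec diamond of size $n$ contains the horizontal domino $[l-1,l+1]\times[m,m+1]$ and that the left square $[l-1,l]\times[m,m+1]$ of this domino is black. For $l,m\in\mathbb{Z}$ and $\alpha\in\{0,1,2,3\}$ with $l+m\equiv\alpha+1\pmod2$, there is a unique rational function $f_{l,m,\alpha}\in\mathbb{Q}(p)$ with $\mathbb{P}(l,m;4p+\alpha)=\frac14+2^{-4p-\alpha}\binom{2p-1}{p}^2f_{l,m,\alpha}(p)$ for all sufficiently large integers $p$. Write $f_{l,m,\alpha}=Z(l,m,\alpha;p)/D(l,m,\alpha;p)$ in lowest terms, so $D(l,m,\alpha;p)$ is the denominator of minimal degree (unique up to a nonzero constant). For an integer $z$ put $z\,\mathrm{div}\,2:=\max(\lfloor z/2\rfloor,0)$. For integers $x$ put $r(x)=x\,\mathrm{div}\,2$ if $x>0$ and $r(x)=(|x|+\alpha-1)\,\mathrm{div}\,2$ if $x\le0$; $s(x)=(x-\alpha+1)\,\mathrm{div}\,2$ if $x\ge0$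 and $s(x)=|x|\,\mathrm{div}\,2$ if $x<0$. For nonnegative integers, $N(u,v,U,V;p):=\prod_{i=1}^{u}(i+p)^{\alpha_i}\prod_{j=1}^{v}(-2j+1+2p)^{\beta_j}$, where $\alpha_i=2$ if $i\le U$ and $1$ otherwise, $\beta_j=2$ if $j\le V$ and $1$ otherwise. With $a=(l+m+\alpha-1)/2$ and $b=(l-m+\alpha-1)/2$ define $$C(l,m,\alpha;p):=N\big(\max[r(a),r(b)],\max[s(a),s(b)],\min[r(a),r(b)],\min[s(a),s(b)];p\big).$$ *)

theory Defs
  imports
    "HOL-Probability.Probability"
    "HOL-Computational_Algebra.Computational_Algebra"
    "HOL-Computational_Algebra.Field_as_Ring"
    "HOL-Number_Theory.Cong"
begin

text \<open>
  A unit square is represented by its lower left corner, a domino by the set of its two unit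
  squares, and a tiling by the set of its dominoes.
\<close>

type_synonym cell = "int \<times> int"

definition unit_square :: "cell \<Rightarrow> (real \<times> real) set" where
  "unit_square c = {of_int (fst c)..of_int (fst c) + 1} \<times> {of_int (snd c)..of_int (snd c) + 1}"

definition aztec_diamond :: "nat \<Rightarrow> cell set" where
  "aztec_diamond n = {c. unit_square c \<subseteq> {(x, y). \<bar>x\<bar> + \<bar>y\<bar> \<le> real n + 1}}"

definition horizontal_domino :: "int \<Rightarrow> int \<Rightarrow> cell set" where
  "horizontal_domino i j = {(i, j), (i + 1, j)}"

definition vertical_domino :: "int \<Rightarrow> int \<Rightarrow> cell set" where
  "vertical_domino i j = {(i, j), (i, j + 1)}"

definition dominoes :: "cell set set" where
  "dominoes = {d. \<exists>i j. d = horizontal_domino i j \<or> d = vertical_domino i j}"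

definition aztec_tilings :: "nat \<Rightarrow> cell set set set" where
  "aztec_tilings n = {T. partition_on (aztec_diamond n) T \<and> T \<subseteq> dominoes}"

text \<open>
  The topmost squares are those with lower left corners \<open>(-1, n - 1)\<close> and \<open>(0, n - 1)\<close>; a square
  is black if it has the chessboard colour of the former.
\<close>

definition black :: "nat \<Rightarrow> cell \<Rightarrow> bool" where
  "black n c \<longleftrightarrow> [fst c + snd c = -1 + (int n - 1)] (mod 2)"

definition domino_prob :: "int \<Rightarrow> int \<Rightarrow> nat \<Rightarrow> real" where
  "domino_prob l m n = measure_pmf.prob (pmf_of_set (aztec_tilings n))
     {T. horizontal_domino (l - 1) m \<in> T \<and> black n (l - 1, m)}"

text \<open>
  Elements of \<open>\<rat>(p)\<close> have type \<^typ>\<open>rat poly fract\<close>, and \<^const>\<open>quot_of_fract\<close> yields their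
  representation in lowest terms (with monic denominator).
\<close>

definition ratfun_eval :: "rat poly fract \<Rightarrow> rat \<Rightarrow> rat" where
  "ratfun_eval g x = poly (fst (quot_of_fract g)) x / poly (snd (quot_of_fract g)) x"

definition represents_prob :: "int \<Rightarrow> int \<Rightarrow> nat \<Rightarrow> rat poly fract \<Rightarrow> bool" where
  "represents_prob l m \<alpha> g \<longleftrightarrow>
     (\<forall>\<^sub>F p in sequentially. domino_prob l m (4 * p + \<alpha>) =
        1 / 4 + (real ((2 * p - 1) choose p))\<^sup>2 / 2 ^ (4 * p + \<alpha>) * of_rat (ratfun_eval g (of_nat p)))"

lemma represents_prob_unique:
  assumes "represents_prob l m \<alpha> g" "represents_prob l m \<alpha> h"
  shows "g = h"
proof -
  define a b c d where "a = fst (quot_of_fract g)" and "b = snd (quot_of_fract g)"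
    and "c = fst (quot_of_fract h)" and "d = snd (quot_of_fract h)"
  have nz: "b \<noteq> 0" "d \<noteq> 0"
    by (simp_all add: b_def d_def)
  have fin: "finite {x. poly b x = 0 \<or> poly d x = 0}"
    using nz by (simp add: poly_roots_finite Collect_disj_eq)
  have "finite (of_nat -` {x. poly b x = 0 \<or> poly d x = 0} :: nat set)"
    by (rule finite_vimageI[OF fin]) (simp add: inj_on_def)
  hence "\<forall>\<^sub>F p in sequentially. p \<notin> of_nat -` {x. poly b x = 0 \<or> poly d x = 0}"
    by (simp add: cofinite_eq_sequentially[symmetric] eventually_cofinite)
  hence "\<forall>\<^sub>F p in sequentially. poly (a * d - c * b) (of_nat p) = 0"
    using assms[unfolded represents_prob_def] eventually_gt_at_top[of 0]
  proof eventually_elim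
    case (elim p)
    have "real ((2 * p - 1) choose p) \<noteq> 0"
      using elim(4) by simp
    hence "(of_rat (ratfun_eval g (of_nat p)) :: real) = of_rat (ratfun_eval h (of_nat p))"
      using elim(2,3) by simp
    hence "ratfun_eval g (of_nat p) = ratfun_eval h (of_nat p)"
      by simp
    thus ?case
      using elim(1) by (simp add: ratfun_eval_def a_def b_def c_def d_def field_simps)
  qed
  then obtain N where N: "\<And>p. p \<ge> N \<Longrightarrow> poly (a * d - c * b) (of_nat p) = 0"
    by (auto simp: eventually_sequentially)
  have "a * d - c * b = 0"
  proof (rule ccontr)
    assume "a * d - c * b \<noteq> 0"
    hence "finite {x. poly (a * d - c * b) x = 0}"
      by (rule poly_roots_finite)
    moreover have "of_nat ` {N..} \<subseteq> {x. poly (a * d - c * b) x = 0}"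
      using N by auto
    ultimately have "finite (of_nat ` {N..} :: rat set)"
      by (rule rev_finite_subset)
    hence "finite {N..}"
      by (rule finite_imageD) (simp add: inj_on_def)
    thus False
      by (simp add: infinite_Ici)
  qed
  hence "Fract a b = Fract c d"
    using nz by (simp add: eq_fract)
  moreover have "Fract a b = g" "Fract c d = h"
    using quot_to_fract_quot_of_fract[of g] quot_to_fract_quot_of_fract[of h]
    by (simp_all add: quot_to_fract_def case_prod_unfold a_def b_def c_def d_def)
  ultimately show ?thesis
    by simp
qed

definition prob_ratfun :: "int \<Rightarrow> int \<Rightarrow> nat \<Rightarrow> rat poly fract" where
  "prob_ratfun l m \<alpha> = (THE g. represents_prob l m \<alpha> g)"

definition D_poly :: "int \<Rightarrow> int \<Rightarrow> nat \<Rightarrow> rat poly" where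
  "D_poly l m \<alpha> = snd (quot_of_fract (prob_ratfun l m \<alpha>))"

text \<open>The conversion to \<^typ>\<open>nat\<close> truncates negative values to \<open>0\<close>.\<close>

definition div2 :: "int \<Rightarrow> nat" where
  "div2 z = nat (z div 2)"

definition r_idx :: "nat \<Rightarrow> int \<Rightarrow> nat" where
  "r_idx \<alpha> x = (if x > 0 then div2 x else div2 (\<bar>x\<bar> + int \<alpha> - 1))"

definition s_idx :: "nat \<Rightarrow> int \<Rightarrow> nat" where
  "s_idx \<alpha> x = (if x \<ge> 0 then div2 (x - int \<alpha> + 1) else div2 \<bar>x\<bar>)"

text \<open>
  The polynomial variable is \<open>p\<close>, so the two linear factors are \<open>i + p\<close> and \<open>-2 j + 1 + 2 p\<close>.
\<close>

definition N_poly :: "nat \<Rightarrow> nat \<Rightarrow> nat \<Rightarrow> nat \<Rightarrow> rat poly" where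
  "N_poly u v U V =
     (\<Prod>i = 1..u. [:of_nat i, 1:] ^ (if i \<le> U then 2 else 1)) *
     (\<Prod>j = 1..v. [:- 2 * of_nat j + 1, 2:] ^ (if j \<le> V then 2 else 1))"

text \<open>
  Both divisions by \<open>2\<close> are exact when \<open>l + m\<close> and \<open>\<alpha> + 1\<close> have the same parity.
\<close>

definition C_poly :: "int \<Rightarrow> int \<Rightarrow> nat \<Rightarrow> rat poly" where
  "C_poly l m \<alpha> =
     (let a = (l + m + int \<alpha> - 1) div 2;
          b = (l - m + int \<alpha> - 1) div 2
      in N_poly (max (r_idx \<alpha> a) (r_idx \<alpha> b)) (max (s_idx \<alpha> a) (s_idx \<alpha> b))
           (min (r_idx \<alpha> a) (r_idx \<alpha> b)) (min (s_idx \<alpha> a) (s_idx \<alpha> b)))"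

end

theory Submission
  imports Defs
begin

text \<open>
The probability of a domino position is determined by a linear recurrence in the size of the
diamond. Cut the plane into \<open>2 \<times> 2\<close> blocks of cells of one chessboard parity. A cell of the diamond
of size \<open>n\<close> lies in two of the blocks of \<open>blocks (Suc n)\<close>, a cell that only the diamond of size
\<open>n + 1\<close> has lies in one. Therefore a choice of a covered part in every block covers the smaller
diamond exactly once if and only if the complementary parts cover the larger one exactly once, and
a part and its complement have the same number of domino partitions up to a factor that multiplies
to a constant. Comparing how a given domino arises in both diamonds yields
\<open>shuffling_recurrence\<close>: the probability of a domino in a block of the larger diamond is the
probability of the opposite domino in the smaller one plus half the creation rate of the block.

Eliminating the domino probabilities leaves a discrete wave equation for the creation rates
(\<open>creation_wave\<close>). In the coordinates \<open>i + j\<close> and \<open>i - j\<close> it is solved by products of two Krawtchouk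
numbers, divided by a power of \<open>2\<close> (\<open>creation_krawtchouk\<close>).

On the axis the probability is a sum of creation rates whose number only depends on \<open>l\<close>. At the centre all four
dominoes of a block have the same probability, which is therefore an affine function of one
creation rate. Following the recurrence along the two vertical directions reaches the blocks
\<open>(0, l)\<close> and \<open>(0, -l)\<close>, whose top dominoes correspond under the symmetries of the diamond to the two
vertical dominoes of the block \<open>(l, 0)\<close>; the sum over that block then gives \<open>top_prob_axis\<close>.

All Krawtchouk numbers in this formula are coefficients near the middle of
\<open>(1 + z)\<^bsup>2p+\<zeta>\<^esup> (1 - z)\<^bsup>2p+\<eta>\<^esup>\<close> with bounded shifts. This is \<open>(1 - z\<^sup>2)\<^bsup>2p-2s-1\<^esup>\<close> times a fixed
polynomial, so such a coefficient is a fixed combination of near-central binomial coefficients,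
and each of these is \<open>binom(2p - 1, p)\<close> times a polynomial in \<open>p\<close> over
\<open>(p + 1) \<dots> (p + r) (2p - 1) (2p - 3) \<dots> (2p - 2s + 1)\<close>. The product of two Krawtchouk numbers has the
square of this denominator, and on the axis that square is exactly \<^const>\<open>C_poly\<close>.
\<close>

section \<open>Cells, blocks and dominoes\<close>

text \<open>
The four cells around the lattice point \<open>b\<close>.
\<close>

definition block :: "cell \<Rightarrow> cell set" where
  "block b = {fst b - 1, fst b} \<times> {snd b - 1, snd b}"

text \<open>
The parity makes every pair of adjacent cells lie in exactly one block, so the blocks partition the
edges of the cell graph into four-cycles.
\<close>

definition blocks :: "nat \<Rightarrow> cell set" where
  "blocks n = {b. \<bar>fst b\<bar> + \<bar>snd b\<bar> < int n \<and> odd (fst b + snd b + int n)}"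

lemma unit_square_subset_iff:
  "unit_square (i, j) \<subseteq> {(x, y). \<bar>x\<bar> + \<bar>y\<bar> \<le> real n + 1} \<longleftrightarrow> \<bar>2 * i + 1\<bar> + \<bar>2 * j + 1\<bar> \<le> 2 * int n"
  (is "?L \<longleftrightarrow> ?R")
proof
  assume ?L
  hence *: "(x, y) \<in> unit_square (i, j) \<Longrightarrow> \<bar>x\<bar> + \<bar>y\<bar> \<le> real n + 1" for x y
    by auto
  have c: "(of_int i, of_int j) \<in> unit_square (i, j)" "(of_int (i + 1), of_int j) \<in> unit_square (i, j)"
    "(of_int i, of_int (j + 1)) \<in> unit_square (i, j)" "(of_int (i + 1), of_int (j + 1)) \<in> unit_square (i, j)"
    by (auto simp: unit_square_def)
  have r: "\<bar>real_of_int x\<bar> + \<bar>real_of_int y\<bar> \<le> real n + 1 \<longleftrightarrow> \<bar>x\<bar> + \<bar>y\<bar> \<le> int n + 1" for x y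
    by linarith
  from c[THEN *, unfolded r] show ?R by arith
next
  assume R: ?R
  show ?L
  proof clarify
    fix x y :: real assume "(x, y) \<in> unit_square (i, j)"
    hence xy: "of_int i \<le> x" "x \<le> of_int i + 1" "of_int j \<le> y" "y \<le> of_int j + 1"
      by (auto simp: unit_square_def)
    have "\<bar>2 * x\<bar> \<le> \<bar>2 * of_int i + 1\<bar> + 1" "\<bar>2 * y\<bar> \<le> \<bar>2 * of_int j + 1\<bar> + 1"
      using xy by linarith+
    moreover have "real_of_int (\<bar>2 * i + 1\<bar> + \<bar>2 * j + 1\<bar>) \<le> real_of_int (2 * int n)"
      using R by (simp only: of_int_le_iff)
    hence "\<bar>2 * real_of_int i + 1\<bar> + \<bar>2 * real_of_int j + 1\<bar> \<le> 2 * real n" by simp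
    ultimately show "\<bar>x\<bar> + \<bar>y\<bar> \<le> real n + 1"
      by (simp add: abs_mult)
  qed
qed

lemma mem_aztec: "(i, j) \<in> aztec_diamond n \<longleftrightarrow> \<bar>2 * i + 1\<bar> + \<bar>2 * j + 1\<bar> \<le> 2 * int n"
  by (simp add: aztec_diamond_def unit_square_subset_iff)

lemma mem_aztec_max: "(i, j) \<in> aztec_diamond n \<longleftrightarrow> max (i + 1) (- i) + max (j + 1) (- j) \<le> int n + 1"
proof -
  have "\<bar>2 * x + 1\<bar> = 2 * max (x + 1) (- x) - 1" for x :: int
    by (auto simp: max_def)
  from this[of i] this[of j] show ?thesis unfolding mem_aztec by linarith
qed

lemma finite_aztec [simp]: "finite (aztec_diamond n)"
proof (rule finite_subset)
  show "aztec_diamond n \<subseteq> {- int n - 1..int n} \<times> {- int n - 1..int n}"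
    by (auto simp: mem_aztec)
qed simp

lemma finite_blocks [simp]: "finite (blocks n)"
proof (rule finite_subset)
  show "blocks n \<subseteq> {- int n..int n} \<times> {- int n..int n}"
    by (auto simp: blocks_def)
qed simp

lemma mem_block: "(i, j) \<in> block (x, y) \<longleftrightarrow> (x = i \<or> x = i + 1) \<and> (y = j \<or> y = j + 1)"
  by (auto simp: block_def)

lemma finite_block [simp]: "finite (block b)"
  by (simp add: block_def)

lemma blocks_containing:
  "{b \<in> blocks n. (i, j) \<in> block b} =
     (if odd (i + j + int n) then {(i, j), (i + 1, j + 1)} else {(i + 1, j), (i, j + 1)}) \<inter> blocks n"
  by (auto simp: blocks_def mem_block)

text \<open>
Of the four lattice points around a cell, two opposite ones have the right parity. For a boundary
cell of the larger diamond one of them is already too far out.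
\<close>

lemma card_blocks_containing:
  "card {b \<in> blocks (Suc n). c \<in> block b} = of_bool (c \<in> aztec_diamond n) + of_bool (c \<in> aztec_diamond (Suc n))"
proof -
  obtain i j where c: "c = (i, j)" by fastforce
  have two: "card ({x, y} \<inter> A) = of_bool (x \<in> A) + of_bool (y \<in> A)" if "x \<noteq> y" for x y :: cell and A
    using that by (auto simp: Int_insert_left)
  show ?thesis
  proof (cases "odd (i + j + int (Suc n))")
    case True
    hence "even (i + j + int n)" by presburger
    then obtain k where "i + j + int n = 2 * k" by (rule evenE)
    hence n: "int n = 2 * k - i - j" by simp
    have mem: "(i, j) \<in> blocks (Suc n) \<longleftrightarrow> \<bar>i\<bar> + \<bar>j\<bar> \<le> int n"
      "(i + 1, j + 1) \<in> blocks (Suc n) \<longleftrightarrow> \<bar>i + 1\<bar> + \<bar>j + 1\<bar> \<le> int n"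
      using True by (auto simp: blocks_def)
    have "of_bool ((i, j) \<in> blocks (Suc n)) + of_bool ((i + 1, j + 1) \<in> blocks (Suc n)) =
      (of_bool ((i, j) \<in> aztec_diamond n) + of_bool ((i, j) \<in> aztec_diamond (Suc n)) :: nat)"
      unfolding mem_aztec_max mem of_nat_Suc n
      by (cases "0 \<le> i"; cases "0 \<le> j"; (simp add: of_bool_def abs_if max_def; presburger))
    thus ?thesis unfolding c blocks_containing using True by (simp add: two del: of_nat_Suc)
  next
    case False
    hence "odd (i + j + int n)" by presburger
    then obtain k where "i + j + int n = 2 * k + 1" by (rule oddE)
    hence n: "int n = 2 * k - i - j + 1" by simp
    have mem: "(i + 1, j) \<in> blocks (Suc n) \<longleftrightarrow> \<bar>i + 1\<bar> + \<bar>j\<bar> \<le> int n"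
      "(i, j + 1) \<in> blocks (Suc n) \<longleftrightarrow> \<bar>i\<bar> + \<bar>j + 1\<bar> \<le> int n"
      using False by (auto simp: blocks_def)
    have "of_bool ((i + 1, j) \<in> blocks (Suc n)) + of_bool ((i, j + 1) \<in> blocks (Suc n)) =
      (of_bool ((i, j) \<in> aztec_diamond n) + of_bool ((i, j) \<in> aztec_diamond (Suc n)) :: nat)"
      unfolding mem_aztec_max mem of_nat_Suc n
      by (cases "0 \<le> i"; cases "0 \<le> j"; (simp add: of_bool_def abs_if max_def; presburger))
    thus ?thesis unfolding c blocks_containing using False by (simp add: two del: of_nat_Suc)
  qed
qed

definition top_of :: "cell \<Rightarrow> cell set" where "top_of b = horizontal_domino (fst b - 1) (snd b)"
definition bottom_of :: "cell \<Rightarrow> cell set" where "bottom_of b = horizontal_domino (fst b - 1) (snd b - 1)"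
definition left_of :: "cell \<Rightarrow> cell set" where "left_of b = vertical_domino (fst b - 1) (snd b - 1)"
definition right_of :: "cell \<Rightarrow> cell set" where "right_of b = vertical_domino (fst b) (snd b - 1)"

lemmas side_defs = top_of_def bottom_of_def left_of_def right_of_def horizontal_domino_def vertical_domino_def

lemma hor_subset_block: "horizontal_domino i j \<subseteq> block (x, y) \<longleftrightarrow> x = i + 1 \<and> (y = j \<or> y = j + 1)"
  by (auto simp: horizontal_domino_def mem_block)

lemma ver_subset_block: "vertical_domino i j \<subseteq> block (x, y) \<longleftrightarrow> y = j + 1 \<and> (x = i \<or> x = i + 1)"
  by (auto simp: vertical_domino_def mem_block)

lemma domino_subset_block_iff:
  "d \<in> dominoes \<and> d \<subseteq> block b \<longleftrightarrow> d \<in> {top_of b, bottom_of b, left_of b, right_of b}" (is "?L \<longleftrightarrow> ?R")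
proof -
  obtain x y where b: "b = (x, y)" by fastforce
  show ?thesis
  proof
    assume ?L
    then obtain i j where "d = horizontal_domino i j \<and> horizontal_domino i j \<subseteq> block (x, y) \<or>
        d = vertical_domino i j \<and> vertical_domino i j \<subseteq> block (x, y)"
      by (auto simp: dominoes_def b)
    thus ?R unfolding hor_subset_block ver_subset_block top_of_def bottom_of_def left_of_def right_of_def b
      by auto
  next
    assume ?R
    hence "d \<in> dominoes"
      unfolding dominoes_def top_of_def bottom_of_def left_of_def right_of_def by auto
    moreover have "d \<subseteq> block b"
      using \<open>?R\<close> by (auto simp: b side_defs mem_block)
    ultimately show ?L by simp
  qed
qed

lemma parity_abs: "even (x + y + (\<bar>x\<bar> + \<bar>y\<bar>))" for x y :: int
  by (cases "0 \<le> x"; cases "0 \<le> y") auto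

lemma ex1_block_hor:
  assumes "horizontal_domino i j \<subseteq> aztec_diamond n" "m = n \<or> m = Suc n"
  shows "\<exists>!b. b \<in> blocks m \<and> horizontal_domino i j \<subseteq> block b"
proof -
  have A: "max (i + 1) (- i) + max (j + 1) (- j) \<le> int n + 1"
    "max (i + 1 + 1) (- (i + 1)) + max (j + 1) (- j) \<le> int n + 1"
    using assms(1) by (simp_all add: horizontal_domino_def mem_aztec_max)
  define y where "y = (if odd (i + 1 + j + int m) then j else j + 1)"
  show ?thesis
  proof (rule ex1I[of _ "(i + 1, y)"])
    have "\<bar>i + 1\<bar> + \<bar>y\<bar> \<le> int n"
    proof -
      have "\<bar>i + 1\<bar> + max (j + 1) (- j) \<le> int n" using A by linarith
      moreover have "\<bar>y\<bar> \<le> max (j + 1) (- j)" unfolding y_def by (auto simp: max_def)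
      ultimately show ?thesis by linarith
    qed
    moreover have "odd (i + 1 + y + int m)"
      unfolding y_def by presburger
    moreover have "m = n \<Longrightarrow> \<bar>i + 1\<bar> + \<bar>y\<bar> \<noteq> int n"
      using \<open>odd (i + 1 + y + int m)\<close> parity_abs[of "i + 1" y] by metis
    ultimately have "\<bar>i + 1\<bar> + \<bar>y\<bar> < int m"
      using assms(2) by linarith
    hence "(i + 1, y) \<in> blocks m"
      using \<open>odd (i + 1 + y + int m)\<close> unfolding blocks_def by simp
    moreover have "horizontal_domino i j \<subseteq> block (i + 1, y)"
      unfolding hor_subset_block by (simp add: y_def)
    ultimately show "(i + 1, y) \<in> blocks m \<and> horizontal_domino i j \<subseteq> block (i + 1, y)"
      by simp
  next
    fix b assume "b \<in> blocks m \<and> horizontal_domino i j \<subseteq> block b"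
    thus "b = (i + 1, y)"
      by (cases b) (auto simp: hor_subset_block blocks_def y_def)
  qed
qed

lemma ex1_block_ver:
  assumes "vertical_domino i j \<subseteq> aztec_diamond n" "m = n \<or> m = Suc n"
  shows "\<exists>!b. b \<in> blocks m \<and> vertical_domino i j \<subseteq> block b"
proof -
  have A: "max (i + 1) (- i) + max (j + 1) (- j) \<le> int n + 1"
    "max (i + 1) (- i) + max (j + 1 + 1) (- (j + 1)) \<le> int n + 1"
    using assms(1) by (simp_all add: vertical_domino_def mem_aztec_max)
  define x where "x = (if odd (i + (j + 1) + int m) then i else i + 1)"
  show ?thesis
  proof (rule ex1I[of _ "(x, j + 1)"])
    have "\<bar>x\<bar> + \<bar>j + 1\<bar> \<le> int n"
    proof -
      have "\<bar>j + 1\<bar> + max (i + 1) (- i) \<le> int n" using A by linarith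
      moreover have "\<bar>x\<bar> \<le> max (i + 1) (- i)" unfolding x_def by (auto simp: max_def)
      ultimately show ?thesis by linarith
    qed
    moreover have "odd (x + (j + 1) + int m)"
      unfolding x_def by presburger
    moreover have "m = n \<Longrightarrow> \<bar>x\<bar> + \<bar>j + 1\<bar> \<noteq> int n"
      using \<open>odd (x + (j + 1) + int m)\<close> parity_abs[of x "j + 1"] by metis
    ultimately have "\<bar>x\<bar> + \<bar>j + 1\<bar> < int m"
      using assms(2) by linarith
    hence "(x, j + 1) \<in> blocks m"
      using \<open>odd (x + (j + 1) + int m)\<close> unfolding blocks_def by simp
    moreover have "vertical_domino i j \<subseteq> block (x, j + 1)"
      unfolding ver_subset_block by (simp add: x_def)
    ultimately show "(x, j + 1) \<in> blocks m \<and> vertical_domino i j \<subseteq> block (x, j + 1)"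
      by simp
  next
    fix b assume "b \<in> blocks m \<and> vertical_domino i j \<subseteq> block b"
    thus "b = (x, j + 1)"
      by (cases b) (auto simp: ver_subset_block blocks_def x_def)
  qed
qed

text \<open>
A domino lies in exactly two blocks of the plane, of opposite parity. Both parities are used: the
same diamond is cut along its own blocks and along those of the next diamond.
\<close>

lemma ex1_block_of_domino:
  assumes "d \<in> dominoes" "d \<subseteq> aztec_diamond n" "m = n \<or> m = Suc n"
  shows "\<exists>!b. b \<in> blocks m \<and> d \<subseteq> block b"
proof -
  from assms(1) obtain i j where "d = horizontal_domino i j \<or> d = vertical_domino i j"
    unfolding dominoes_def by blast
  thus ?thesis
    using ex1_block_hor[of i j n m] ex1_block_ver[of i j n m] assms(2,3) by metis
qed

section \<open>Domino partitions of a block\<close>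

definition domino_partitions :: "cell set \<Rightarrow> cell set set set" where
  "domino_partitions X = {D. D \<subseteq> dominoes \<and> partition_on X D}"

lemma tilings_eq: "aztec_tilings n = domino_partitions (aztec_diamond n)"
  by (auto simp: aztec_tilings_def domino_partitions_def)

lemma finite_domino_partitions [simp]: "finite X \<Longrightarrow> finite (domino_partitions X)"
  by (rule finite_subset[of _ "Pow (Pow X)"]) (auto simp: domino_partitions_def partition_on_def)

lemma sides_disjoint:
  "top_of b \<inter> bottom_of b = {}" "left_of b \<inter> right_of b = {}"
  "top_of b \<inter> left_of b \<noteq> {}" "top_of b \<inter> right_of b \<noteq> {}"
  "bottom_of b \<inter> left_of b \<noteq> {}" "bottom_of b \<inter> right_of b \<noteq> {}"
  "top_of b \<noteq> bottom_of b" "left_of b \<noteq> right_of b"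
  by (cases b; auto simp: side_defs doubleton_eq_iff)+

lemma sides_union:
  "top_of b \<union> bottom_of b = block b" "left_of b \<union> right_of b = block b"
  by (cases b; auto simp: side_defs block_def)+

lemma card_sides: "card (block b) = 4" "card (top_of b) = 2" "card (bottom_of b) = 2"
  "card (left_of b) = 2" "card (right_of b) = 2"
  by (cases b; simp add: side_defs block_def card_cartesian_product)+

lemma sides_neq:
  "top_of b \<noteq> {}" "bottom_of b \<noteq> {}" "left_of b \<noteq> {}" "right_of b \<noteq> {}" "block b \<noteq> {}"
  "top_of b \<noteq> bottom_of b" "top_of b \<noteq> left_of b" "top_of b \<noteq> right_of b" "top_of b \<noteq> block b"
  "bottom_of b \<noteq> left_of b" "bottom_of b \<noteq> right_of b" "bottom_of b \<noteq> block b"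
  "left_of b \<noteq> right_of b" "left_of b \<noteq> block b" "right_of b \<noteq> block b"
proof -
  have "X \<noteq> {}" "X \<noteq> block b" if "card X = 2" for X :: "cell set"
    using that card_sides[of b] by auto
  from this[OF card_sides(2)] this[OF card_sides(3)] this[OF card_sides(4)] this[OF card_sides(5)]
  show "top_of b \<noteq> {}" "bottom_of b \<noteq> {}" "left_of b \<noteq> {}" "right_of b \<noteq> {}"
    "top_of b \<noteq> block b" "bottom_of b \<noteq> block b" "left_of b \<noteq> block b" "right_of b \<noteq> block b"
    by blast+
  show "block b \<noteq> {}" using card_sides(1)[of b] by auto
  show "top_of b \<noteq> left_of b" "top_of b \<noteq> right_of b" "bottom_of b \<noteq> left_of b" "bottom_of b \<noteq> right_of b"
    using sides_disjoint[of b] by (metis Int_commute)+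
  show "top_of b \<noteq> bottom_of b" "left_of b \<noteq> right_of b"
    by (fact sides_disjoint)+
qed

lemma subset_pair: "D \<subseteq> {x, y} \<Longrightarrow> D = {} \<or> D = {x} \<or> D = {y} \<or> D = {x, y}"
  by auto

lemma subset_of_two_pairs:
  assumes "D \<subseteq> {t, b, l, r}" "\<not> (t \<in> D \<and> l \<in> D)" "\<not> (t \<in> D \<and> r \<in> D)"
    "\<not> (b \<in> D \<and> l \<in> D)" "\<not> (b \<in> D \<and> r \<in> D)"
  shows "D \<in> {{}, {t}, {b}, {l}, {r}, {t, b}, {l, r}}"
proof (cases "l \<in> D \<or> r \<in> D")
  case True
  hence "D \<subseteq> {l, r}" using assms by auto
  from subset_pair[OF this] show ?thesis by (elim disjE; simp only: insert_iff simp_thms)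
next
  case False
  hence "D \<subseteq> {t, b}" using assms by auto
  from subset_pair[OF this] show ?thesis by (elim disjE; simp only: insert_iff simp_thms)
qed

lemma disjoint_none: "disjoint {}"
  by (simp add: disjoint_def)

lemma disjoint_singleton: "disjoint {x}"
  by (simp add: disjoint_def)

lemma disjoint_pair: "x \<inter> y = {} \<Longrightarrow> disjoint {x, y}"
  by (auto simp: disjoint_def)

lemma domino_partitions_in_block:
  assumes "X \<subseteq> block b"
  shows "domino_partitions X = {D \<in> {{}, {top_of b}, {bottom_of b}, {left_of b}, {right_of b},
     {top_of b, bottom_of b}, {left_of b, right_of b}}. \<Union>D = X}" (is "_ = {D \<in> ?S. _}")
proof (intro equalityI subsetI)
  fix D assume "D \<in> domino_partitions X"
  hence D: "D \<subseteq> dominoes" "\<Union>D = X" "disjoint D"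
    by (auto simp: domino_partitions_def partition_on_def)
  have sub: "D \<subseteq> {top_of b, bottom_of b, left_of b, right_of b}"
  proof
    fix x assume "x \<in> D"
    hence "x \<in> dominoes \<and> x \<subseteq> block b" using D(1,2) assms by blast
    thus "x \<in> {top_of b, bottom_of b, left_of b, right_of b}"
      by (simp only: domino_subset_block_iff)
  qed
  have mixed: "\<not> (x \<in> D \<and> y \<in> D)" if "x \<in> {top_of b, bottom_of b}" "y \<in> {left_of b, right_of b}" for x y
  proof
    assume "x \<in> D \<and> y \<in> D"
    moreover have "x \<inter> y \<noteq> {}" using that sides_disjoint[of b] by auto
    ultimately have "x = y" using D(3) unfolding disjoint_def by metis
    with that have "top_of b \<in> {left_of b, right_of b} \<or> bottom_of b \<in> {left_of b, right_of b}"
      by fast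
    thus False using sides_neq[of b] by simp
  qed
  have "D \<in> ?S"
    by (rule subset_of_two_pairs[OF sub]; rule mixed; simp)
  thus "D \<in> {D \<in> ?S. \<Union>D = X}" using D(2) by simp
next
  fix D assume "D \<in> {D \<in> ?S. \<Union>D = X}"
  hence D: "D \<in> ?S" "\<Union>D = X" by auto
  have "{top_of b, bottom_of b, left_of b, right_of b} \<subseteq> dominoes"
    unfolding subset_iff domino_subset_block_iff[symmetric] by simp
  hence "D \<subseteq> dominoes" using D(1) by auto
  moreover have "disjoint D"
    using D(1) disjoint_pair[OF sides_disjoint(1)] disjoint_pair[OF sides_disjoint(2)]
    by (elim insertE emptyE; simp only: disjoint_singleton disjoint_none)
  moreover have "{} \<notin> D"
    using D(1) sides_neq[of b] by (elim insertE emptyE; simp)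
  ultimately show "D \<in> domino_partitions X"
    using D by (simp add: domino_partitions_def partition_on_def)
qed

definition sides :: "cell \<Rightarrow> cell set set" where
  "sides b = {top_of b, bottom_of b, left_of b, right_of b}"

lemma filter_insert:
  "{D \<in> insert a A. P D} = (if P a then insert a {D \<in> A. P D} else {D \<in> A. P D})"
  by auto

lemma domino_partitions_empty: "domino_partitions {} = {{}}"
  by (auto simp: domino_partitions_def partition_on_empty)

lemma domino_partitions_side:
  assumes "d \<in> sides b" shows "domino_partitions d = {{d}}"
proof -
  have "d \<in> dominoes \<and> d \<subseteq> block b"
    using assms unfolding sides_def domino_subset_block_iff .
  hence "d \<subseteq> block b" by simp
  hence "domino_partitions d = {D \<in> {{}, {top_of b}, {bottom_of b}, {left_of b}, {right_of b},
     {top_of b, bottom_of b}, {left_of b, right_of b}}. \<Union>D = d}"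
    by (rule domino_partitions_in_block)
  moreover have "d = top_of b \<or> d = bottom_of b \<or> d = left_of b \<or> d = right_of b"
    using assms by (simp add: sides_def)
  ultimately show ?thesis
    by (elim disjE; simp add: filter_insert sides_union sides_neq sides_neq[symmetric] del: insert_iff)
qed

lemma domino_partitions_full:
  "domino_partitions (block b) = {{top_of b, bottom_of b}, {left_of b, right_of b}}"
proof -
  have "domino_partitions (block b) = {D \<in> {{}, {top_of b}, {bottom_of b}, {left_of b}, {right_of b},
     {top_of b, bottom_of b}, {left_of b, right_of b}}. \<Union>D = block b}"
    by (rule domino_partitions_in_block) simp
  thus ?thesis
    by (simp add: filter_insert sides_union sides_neq sides_neq[symmetric] del: insert_iff)
qed

lemma domino_partitions_other:
  assumes "X \<subseteq> block b" "X \<notin> insert {} (insert (block b) (sides b))"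
  shows "domino_partitions X = {}"
  unfolding domino_partitions_in_block[OF assms(1)]
  unfolding filter_insert
  using assms(2) by (simp add: sides_def sides_union eq_commute[of _ X])

lemma sides_complement:
  "block b - top_of b = bottom_of b" "block b - bottom_of b = top_of b"
  "block b - left_of b = right_of b" "block b - right_of b = left_of b"
  using sides_union[of b] sides_disjoint(1,2)[of b] by auto

definition num_fillings :: "cell set \<Rightarrow> real" where "num_fillings X = real (card (domino_partitions X))"

lemma num_fillings_empty: "num_fillings {} = 1" and num_fillings_block: "num_fillings (block b) = 2"
  by (simp_all add: num_fillings_def domino_partitions_empty domino_partitions_full doubleton_eq_iff sides_neq)

lemma num_fillings_side: "d \<in> sides b \<Longrightarrow> num_fillings d = 1"
  by (simp add: num_fillings_def domino_partitions_side)

lemma side_cases: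
  assumes "X \<subseteq> block b"
  obtains "X = {}" | "X = block b" | "X \<in> sides b" | "X \<notin> sides b" "X \<noteq> {}" "X \<noteq> block b" "domino_partitions X = {}"
  using domino_partitions_other[OF assms] by blast

lemma complement_side: "d \<in> sides b \<Longrightarrow> block b - d \<in> sides b"
  unfolding sides_def by (elim insertE emptyE) (simp_all add: sides_complement)

lemma side_subset: "d \<in> sides b \<Longrightarrow> d \<subseteq> block b"
  using domino_subset_block_iff[of d b] unfolding sides_def by blast

lemma side_neq: "d \<in> sides b \<Longrightarrow> d \<noteq> {}" "d \<in> sides b \<Longrightarrow> d \<noteq> block b"
  unfolding sides_def by (elim insertE emptyE; simp add: sides_neq)+

lemma card_side: "d \<in> sides b \<Longrightarrow> card d = 2"
  unfolding sides_def by (elim insertE emptyE) (simp_all add: card_sides)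

text \<open>
A part of a block that admits a domino partition is empty, one of the four sides, or full, with
\<open>1\<close>, \<open>1\<close> and \<open>2\<close> domino partitions. The factor \<open>sqrt 2\<close> per cell turns this into an identity whose
product over all blocks only depends on the total number of covered cells.
\<close>

lemma num_fillings_complement:
  assumes "X \<subseteq> block b"
  shows "num_fillings (block b - X) * sqrt 2 ^ card X = 2 * num_fillings X"
  using assms
proof (cases rule: side_cases)
  case 1
  thus ?thesis by (simp add: num_fillings_empty num_fillings_block)
next
  case 2
  have "sqrt 2 ^ 4 = (sqrt 2 ^ 2) ^ 2" by (simp only: power_mult[symmetric]) simp
  hence "sqrt 2 ^ 4 = 4" by simp
  with 2 show ?thesis by (simp add: num_fillings_empty num_fillings_block card_sides)
next
  case 3
  thus ?thesis by (simp add: num_fillings_side[OF complement_side] num_fillings_side card_side)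
next
  case 4
  have X: "block b - (block b - X) = X" using assms by (simp add: double_diff)
  from assms have "block b - X \<subseteq> block b" by simp
  thus ?thesis
  proof (cases rule: side_cases)
    case 1
    with X 4(3) show ?thesis by simp
  next
    case 2
    with X 4(2) show ?thesis by simp
  next
    case 3
    from complement_side[OF this] X 4(1) show ?thesis by simp
  next
    case 4
    thus ?thesis using \<open>domino_partitions X = {}\<close> by (simp add: num_fillings_def)
  qed
qed

text \<open>
A full block is filled by two horizontal or by two vertical dominoes, so any given side occurs in
half of its partitions.
\<close>

lemma card_partitions_containing:
  assumes "X \<subseteq> block b" "d \<in> sides b"
  shows "real (card {D \<in> domino_partitions X. d \<in> D}) = num_fillings X * (of_bool (X = d) + of_bool (X = block b) / 2)"
  using assms(1)
proof (cases rule: side_cases)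
  case 1
  thus ?thesis using side_neq[OF assms(2)] sides_neq(5)[of b] by (simp add: domino_partitions_empty)
next
  case 2
  have "card {D \<in> domino_partitions X. d \<in> D} = 1"
    using assms(2) unfolding 2 domino_partitions_full sides_def filter_insert
    by (elim insertE emptyE) (simp_all add: sides_neq sides_neq[symmetric])
  thus ?thesis using side_neq(2)[OF assms(2)] by (simp add: 2 num_fillings_block)
next
  case 3
  have "{D. D = {X} \<and> d \<in> D} = (if X = d then {{X}} else {})" by auto
  thus ?thesis using side_neq(2)[OF 3] by (simp add: domino_partitions_side[OF 3] num_fillings_side[OF 3])
next
  case 4
  thus ?thesis by (simp add: num_fillings_def)
qed

section \<open>The shuffling recurrence\<close>

text \<open>
The families of parts of blocks that cover each cell of \<open>A\<close> exactly once and no other cell. A tiling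
induces such a family by forgetting how the part of every block is divided into dominoes.
\<close>

definition covers :: "nat \<Rightarrow> cell set \<Rightarrow> (cell \<Rightarrow> cell set) set" where
  "covers m A = {X \<in> PiE (blocks m) (\<lambda>b. Pow (block b)). \<forall>c. card {b \<in> blocks m. c \<in> X b} = of_bool (c \<in> A)}"

definition block_dominoes :: "nat \<Rightarrow> cell set set \<Rightarrow> cell \<Rightarrow> cell set set" where
  "block_dominoes m T = (\<lambda>b\<in>blocks m. {d \<in> T. d \<subseteq> block b})"

definition cover_of :: "nat \<Rightarrow> cell set set \<Rightarrow> cell \<Rightarrow> cell set" where
  "cover_of m T = (\<lambda>b\<in>blocks m. \<Union>(block_dominoes m T b))"

lemma finite_covers [simp]: "finite (covers m A)"
  unfolding covers_def by (rule finite_subset[OF _ finite_PiE[of "blocks m" "\<lambda>b. Pow (block b)"]]) auto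

lemma coversD:
  assumes "X \<in> covers m A"
  shows "b \<in> blocks m \<Longrightarrow> X b \<subseteq> block b" "b \<in> blocks m \<Longrightarrow> X b \<subseteq> A"
    "c \<in> A \<Longrightarrow> \<exists>b\<in>blocks m. c \<in> X b"
    "\<lbrakk>b \<in> blocks m; b' \<in> blocks m; b \<noteq> b'\<rbrakk> \<Longrightarrow> X b \<inter> X b' = {}"
    "X \<in> extensional (blocks m)"
proof -
  have X: "X \<in> PiE (blocks m) (\<lambda>b. Pow (block b))"
    and c: "card {b \<in> blocks m. c \<in> X b} = of_bool (c \<in> A)" for c
    using assms unfolding covers_def by blast+
  show "b \<in> blocks m \<Longrightarrow> X b \<subseteq> block b" using X by (auto simp: PiE_iff)
  show "X \<in> extensional (blocks m)" using X by (auto simp: PiE_iff)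
  show "X b \<subseteq> A" if "b \<in> blocks m"
  proof
    fix c assume "c \<in> X b"
    hence "{b \<in> blocks m. c \<in> X b} \<noteq> {}" using that by blast
    hence "card {b \<in> blocks m. c \<in> X b} \<noteq> 0" by simp
    thus "c \<in> A" using c[of c] by (auto split: if_splits)
  qed
  show "\<exists>b\<in>blocks m. c \<in> X b" if "c \<in> A"
  proof -
    have "card {b \<in> blocks m. c \<in> X b} \<noteq> 0" using c[of c] that by simp
    hence "{b \<in> blocks m. c \<in> X b} \<noteq> {}" by (metis card.empty)
    thus ?thesis by blast
  qed
  show "X b \<inter> X b' = {}" if "b \<in> blocks m" "b' \<in> blocks m" "b \<noteq> b'"
  proof (rule ccontr)
    assume "X b \<inter> X b' \<noteq> {}"
    then obtain x where "x \<in> X b" "x \<in> X b'" by blast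
    hence "{b, b'} \<subseteq> {b \<in> blocks m. x \<in> X b}" using that by auto
    hence "card {b, b'} \<le> card {b \<in> blocks m. x \<in> X b}" by (rule card_mono[rotated]) simp
    thus False using that(3) c[of x] by (auto simp: of_bool_def split: if_splits)
  qed
qed

lemma tilingD:
  assumes "T \<in> aztec_tilings n"
  shows "T \<subseteq> dominoes" "\<Union>T = aztec_diamond n" "d \<in> T \<Longrightarrow> d' \<in> T \<Longrightarrow> d \<noteq> d' \<Longrightarrow> d \<inter> d' = {}" "{} \<notin> T"
  using assms by (auto simp: aztec_tilings_def partition_on_def disjoint_def)

lemma cover_of_tiling:
  assumes T: "T \<in> aztec_tilings n" and m: "m = n \<or> m = Suc n"
  shows "cover_of m T \<in> covers m (aztec_diamond n)"
proof -
  have mem: "c \<in> cover_of m T b \<longleftrightarrow> (\<exists>d\<in>T. d \<subseteq> block b \<and> c \<in> d)" if "b \<in> blocks m" for b c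
    using that by (simp add: cover_of_def block_dominoes_def) blast
  have "card {b \<in> blocks m. c \<in> cover_of m T b} = of_bool (c \<in> aztec_diamond n)" for c
  proof (cases "c \<in> aztec_diamond n")
    case True
    then obtain d where d: "d \<in> T" "c \<in> d" using tilingD(2)[OF T] by blast
    have "d \<in> dominoes" "d \<subseteq> aztec_diamond n" using tilingD(1,2)[OF T] d by blast+
    from ex1_block_of_domino[OF this m] obtain b where
      b: "b \<in> blocks m" "d \<subseteq> block b" "\<And>b'. b' \<in> blocks m \<Longrightarrow> d \<subseteq> block b' \<Longrightarrow> b' = b"
      by blast
    have "{b \<in> blocks m. c \<in> cover_of m T b} = {b}"
    proof (intro equalityI subsetI)
      fix b' assume "b' \<in> {b \<in> blocks m. c \<in> cover_of m T b}"
      then obtain d' where d': "b' \<in> blocks m" "d' \<in> T" "d' \<subseteq> block b'" "c \<in> d'"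
        using mem by blast
      hence "d' = d" using tilingD(3)[OF T, of d d'] d by blast
      thus "b' \<in> {b}" using b(3) d' by simp
    next
      fix b' assume "b' \<in> {b}"
      thus "b' \<in> {b \<in> blocks m. c \<in> cover_of m T b}"
        using mem[OF b(1)] b d by blast
    qed
    thus ?thesis using True by simp
  next
    case False
    hence "{b \<in> blocks m. c \<in> cover_of m T b} = {}"
      using tilingD(2)[OF T] mem by blast
    thus ?thesis using False by simp
  qed
  moreover have "cover_of m T \<in> PiE (blocks m) (\<lambda>b. Pow (block b))"
  proof (rule PiE_I)
    show "cover_of m T b \<in> Pow (block b)" if "b \<in> blocks m" for b
      using mem[OF that] by blast
  qed (simp add: cover_of_def)
  ultimately show ?thesis by (simp add: covers_def)
qed

text \<open>
Once the covered part of every block is fixed, the blocks can be filled independently of each other.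
\<close>

lemma bij_betw_tilings_with_cover:
  assumes m: "m = n \<or> m = Suc n" and X: "X \<in> covers m (aztec_diamond n)"
  shows "bij_betw (block_dominoes m) {T \<in> aztec_tilings n. cover_of m T = X}
           (PiE (blocks m) (\<lambda>b. domino_partitions (X b)))"
proof (rule bij_betw_byWitness[where f' = "\<lambda>f. \<Union>b\<in>blocks m. f b"])
  note XD = coversD[OF X]
  have F: "f b \<subseteq> dominoes" "\<Union>(f b) = X b" "disjoint (f b)" "{} \<notin> f b"
    if "f \<in> PiE (blocks m) (\<lambda>b. domino_partitions (X b))" "b \<in> blocks m" for f b
  proof -
    have "f b \<in> domino_partitions (X b)" using that by (auto simp: PiE_iff)
    thus "f b \<subseteq> dominoes" "\<Union>(f b) = X b" "disjoint (f b)" "{} \<notin> f b"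
      by (auto simp: domino_partitions_def partition_on_def)
  qed
  have inv: "block_dominoes m (\<Union>b\<in>blocks m. f b) = f"
    if f: "f \<in> PiE (blocks m) (\<lambda>b. domino_partitions (X b))" for f
  proof
    fix b show "block_dominoes m (\<Union>b\<in>blocks m. f b) b = f b"
    proof (cases "b \<in> blocks m")
      case True
      have "d \<in> f b" if d: "b' \<in> blocks m" "d \<in> f b'" "d \<subseteq> block b" for d b'
      proof -
        have "d \<subseteq> X b'" using F(2)[OF f d(1)] d(2) by blast
        hence "d \<subseteq> aztec_diamond n" "d \<subseteq> block b'" using XD(1,2)[OF d(1)] by auto
        moreover have "d \<in> dominoes" using F(1)[OF f d(1)] d(2) by blast
        ultimately have "b = b'" using ex1_block_of_domino[OF _ _ m, of d] True d(1,3) by blast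
        thus ?thesis using d(2) by simp
      qed
      moreover have "d \<subseteq> block b" if "d \<in> f b" for d
        using F(2)[OF f True] that XD(1)[OF True] by blast
      ultimately have "{d \<in> \<Union>b\<in>blocks m. f b. d \<subseteq> block b} = f b" using True by blast
      thus ?thesis using True by (simp add: block_dominoes_def)
    next
      case False
      hence "f b = undefined" using PiE_arb[OF f] by simp
        thus ?thesis using False by (simp add: block_dominoes_def)
    qed
  qed
  show "\<forall>f\<in>PiE (blocks m) (\<lambda>b. domino_partitions (X b)). block_dominoes m (\<Union>b\<in>blocks m. f b) = f"
    using inv by blast
  show "\<forall>T\<in>{T \<in> aztec_tilings n. cover_of m T = X}. (\<Union>b\<in>blocks m. block_dominoes m T b) = T"
  proof
    fix T assume "T \<in> {T \<in> aztec_tilings n. cover_of m T = X}"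
    hence T: "T \<in> aztec_tilings n" by simp
    show "(\<Union>b\<in>blocks m. block_dominoes m T b) = T"
    proof (intro equalityI subsetI)
      fix d assume d: "d \<in> T"
      have "d \<in> dominoes" "d \<subseteq> aztec_diamond n" using tilingD(1,2)[OF T] d by blast+
      then obtain b where "b \<in> blocks m" "d \<subseteq> block b" using ex1_block_of_domino[OF _ _ m] by blast
      thus "d \<in> (\<Union>b\<in>blocks m. block_dominoes m T b)" using d by (auto simp: block_dominoes_def)
    qed (auto simp: block_dominoes_def)
  qed
  show "block_dominoes m ` {T \<in> aztec_tilings n. cover_of m T = X} \<subseteq> PiE (blocks m) (\<lambda>b. domino_partitions (X b))"
  proof (rule image_subsetI)
    fix T assume "T \<in> {T \<in> aztec_tilings n. cover_of m T = X}"
    hence T: "T \<in> aztec_tilings n" and c: "cover_of m T = X" by simp_all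
    have "block_dominoes m T b \<in> domino_partitions (X b)" if b: "b \<in> blocks m" for b
    proof -
      have "\<Union>(block_dominoes m T b) = X b" using b c by (auto simp: cover_of_def)
      moreover have sub: "block_dominoes m T b \<subseteq> T" using b by (auto simp: block_dominoes_def)
      moreover have "block_dominoes m T b \<subseteq> dominoes" using sub tilingD(1)[OF T] by blast
      moreover have "disjoint (block_dominoes m T b)" using sub tilingD(3)[OF T] unfolding disjoint_def by blast
      moreover have "{} \<notin> block_dominoes m T b" using sub tilingD(4)[OF T] by blast
      ultimately show ?thesis by (simp add: domino_partitions_def partition_on_def)
    qed
    thus "block_dominoes m T \<in> PiE (blocks m) (\<lambda>b. domino_partitions (X b))"
      by (auto simp: PiE_iff block_dominoes_def extensional_def)
  qed
  show "(\<lambda>f. \<Union>b\<in>blocks m. f b) ` PiE (blocks m) (\<lambda>b. domino_partitions (X b))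
    \<subseteq> {T \<in> aztec_tilings n. cover_of m T = X}"
  proof (rule image_subsetI)
    fix f assume f: "f \<in> PiE (blocks m) (\<lambda>b. domino_partitions (X b))"
    let ?T = "\<Union>b\<in>blocks m. f b"
    have "?T \<subseteq> dominoes" using F(1)[OF f] by blast
    moreover have "\<Union>?T = aztec_diamond n"
    proof -
      have "\<Union>?T = (\<Union>b\<in>blocks m. X b)" using F(2)[OF f] by blast
      also have "\<dots> = aztec_diamond n" using XD(2,3) by blast
      finally show ?thesis .
    qed
    moreover have "{} \<notin> ?T" using F(4)[OF f] by blast
    moreover have "disjoint ?T"
    proof (rule disjointI)
      fix d d' assume d: "d \<in> ?T" "d' \<in> ?T" "d \<noteq> d'"
      then obtain b b' where b: "b \<in> blocks m" "d \<in> f b" "b' \<in> blocks m" "d' \<in> f b'" by blast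
      show "d \<inter> d' = {}"
      proof (cases "b = b'")
        case True
        thus ?thesis using F(3)[OF f b(1)] b d(3) unfolding disjoint_def by blast
      next
        case False
        have "d \<subseteq> X b" "d' \<subseteq> X b'" using F(2)[OF f] b by blast+
        thus ?thesis using XD(4)[OF b(1,3) False] by blast
      qed
    qed
    ultimately have "?T \<in> aztec_tilings n" by (simp add: aztec_tilings_def partition_on_def)
    moreover have "cover_of m ?T = X"
    proof
      fix b show "cover_of m ?T b = X b"
        unfolding cover_of_def inv[OF f] using F(2)[OF f, of b] extensional_arb[OF XD(5), of b] by simp
    qed
    ultimately show "?T \<in> {T \<in> aztec_tilings n. cover_of m T = X}" by simp
  qed
qed

lemma finite_tilings [simp]: "finite (aztec_tilings n)"
  by (simp add: tilings_eq)

lemma bij_betw_filter: "bij_betw f A B \<Longrightarrow> bij_betw f {x \<in> A. P (f x)} {y \<in> B. P y}"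
  by (auto simp: bij_betw_def inj_on_def)

lemma PiE_filter:
  assumes "i \<in> I"
  shows "{f \<in> PiE I F. Q (f i)} = PiE I (\<lambda>j. if j = i then {y \<in> F i. Q y} else F j)"
  using assms by (auto simp: PiE_iff extensional_def split: if_splits)

lemma card_tilings_restricted:
  assumes m: "m = n \<or> m = Suc n" and b0: "b0 \<in> blocks m"
  shows "card {T \<in> aztec_tilings n. Q {d \<in> T. d \<subseteq> block b0}} =
    (\<Sum>X\<in>covers m (aztec_diamond n). card {D \<in> domino_partitions (X b0). Q D} *
       (\<Prod>b\<in>blocks m - {b0}. card (domino_partitions (X b))))"
proof -
  let ?C = "covers m (aztec_diamond n)"
  let ?S = "{T \<in> aztec_tilings n. Q {d \<in> T. d \<subseteq> block b0}}"
  have "card ?S = (\<Sum>T\<in>?S. 1)" by simp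
  also have "\<dots> = (\<Sum>X\<in>?C. \<Sum>T\<in>{T\<in>?S. cover_of m T = X}. 1)"
    by (rule sum.group[symmetric]) (use cover_of_tiling[OF _ m] in auto)
  also have "\<dots> = (\<Sum>X\<in>?C. card {D \<in> domino_partitions (X b0). Q D} *
       (\<Prod>b\<in>blocks m - {b0}. card (domino_partitions (X b))))"
  proof (rule sum.cong[OF refl])
    fix X assume X: "X \<in> ?C"
    let ?G = "\<lambda>b. if b = b0 then {D \<in> domino_partitions (X b0). Q D} else domino_partitions (X b)"
    have "bij_betw (block_dominoes m) {T \<in> {T \<in> aztec_tilings n. cover_of m T = X}. Q (block_dominoes m T b0)}
       {f \<in> PiE (blocks m) (\<lambda>b. domino_partitions (X b)). Q (f b0)}"
      by (rule bij_betw_filter[OF bij_betw_tilings_with_cover[OF m X], of "\<lambda>f. Q (f b0)"])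
    hence "card {T \<in> {T \<in> aztec_tilings n. cover_of m T = X}. Q (block_dominoes m T b0)} = card (PiE (blocks m) ?G)"
      unfolding PiE_filter[OF b0] by (rule bij_betw_same_card)
    also have "{T \<in> {T \<in> aztec_tilings n. cover_of m T = X}. Q (block_dominoes m T b0)} = {T\<in>?S. cover_of m T = X}"
      using b0 by (simp add: block_dominoes_def conj_ac)
    finally have "card {T\<in>?S. cover_of m T = X} = card (PiE (blocks m) ?G)" .
    also have "\<dots> = (\<Prod>b\<in>blocks m. card (?G b))" by (simp add: card_PiE)
    also have "\<dots> = card (?G b0) * (\<Prod>b\<in>blocks m - {b0}. card (?G b))"
      by (rule prod.remove) (use b0 in auto)
    also have "(\<Prod>b\<in>blocks m - {b0}. card (?G b)) = (\<Prod>b\<in>blocks m - {b0}. card (domino_partitions (X b)))"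
      by (rule prod.cong) auto
    finally show "(\<Sum>T\<in>{T\<in>?S. cover_of m T = X}. 1) = card {D \<in> domino_partitions (X b0). Q D} *
       (\<Prod>b\<in>blocks m - {b0}. card (domino_partitions (X b)))" by simp
  qed
  finally show ?thesis .
qed

text \<open>
The number of tilings with the cover \<open>X\<close>.
\<close>

definition cover_weight :: "nat \<Rightarrow> (cell \<Rightarrow> cell set) \<Rightarrow> real" where
  "cover_weight m X = (\<Prod>b\<in>blocks m. num_fillings (X b))"

lemma cover_weight_remove:
  "b0 \<in> blocks m \<Longrightarrow> cover_weight m X = num_fillings (X b0) * (\<Prod>b\<in>blocks m - {b0}. num_fillings (X b))"
  unfolding cover_weight_def by (rule prod.remove) auto

lemma card_tilings:
  assumes m: "m = n \<or> m = Suc n" and b0: "b0 \<in> blocks m"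
  shows "real (card (aztec_tilings n)) = (\<Sum>X\<in>covers m (aztec_diamond n). cover_weight m X)"
  using card_tilings_restricted[OF assms, of "\<lambda>_. True"]
  by (simp add: cover_weight_remove[OF b0] num_fillings_def)

lemma card_tilings_containing:
  assumes m: "m = n \<or> m = Suc n" and b0: "b0 \<in> blocks m" and d: "d \<in> sides b0"
  shows "real (card {T \<in> aztec_tilings n. d \<in> T}) = (\<Sum>X\<in>covers m (aztec_diamond n).
    cover_weight m X * (of_bool (X b0 = d) + of_bool (X b0 = block b0) / 2))"
proof -
  have "{T \<in> aztec_tilings n. d \<in> T} = {T \<in> aztec_tilings n. d \<in> {d \<in> T. d \<subseteq> block b0}}"
    using side_subset[OF d] by auto
  hence "real (card {T \<in> aztec_tilings n. d \<in> T}) = (\<Sum>X\<in>covers m (aztec_diamond n).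
     real (card {D \<in> domino_partitions (X b0). d \<in> D}) * (\<Prod>b\<in>blocks m - {b0}. num_fillings (X b)))"
    using card_tilings_restricted[OF m b0, of "\<lambda>D. d \<in> D"] by (simp add: num_fillings_def)
  also have "\<dots> = (\<Sum>X\<in>covers m (aztec_diamond n).
    cover_weight m X * (of_bool (X b0 = d) + of_bool (X b0 = block b0) / 2))"
  proof (rule sum.cong[OF refl])
    fix X assume "X \<in> covers m (aztec_diamond n)"
    from card_partitions_containing[OF coversD(1)[OF this b0] d]
    show "real (card {D \<in> domino_partitions (X b0). d \<in> D}) * (\<Prod>b\<in>blocks m - {b0}. num_fillings (X b)) =
      cover_weight m X * (of_bool (X b0 = d) + of_bool (X b0 = block b0) / 2)"
      by (simp add: cover_weight_remove[OF b0])
  qed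
  finally show ?thesis .
qed

definition complement_cover :: "nat \<Rightarrow> (cell \<Rightarrow> cell set) \<Rightarrow> cell \<Rightarrow> cell set" where
  "complement_cover m X = (\<lambda>b\<in>blocks m. block b - X b)"

lemma card_complement_cover:
  assumes "\<And>b. b \<in> blocks (Suc n) \<Longrightarrow> X b \<subseteq> block b"
  shows "card {b \<in> blocks (Suc n). c \<in> complement_cover (Suc n) X b} + card {b \<in> blocks (Suc n). c \<in> X b} =
    of_bool (c \<in> aztec_diamond n) + of_bool (c \<in> aztec_diamond (Suc n))"
proof -
  have "card {b \<in> blocks (Suc n). c \<in> complement_cover (Suc n) X b} + card {b \<in> blocks (Suc n). c \<in> X b} =
    card ({b \<in> blocks (Suc n). c \<in> complement_cover (Suc n) X b} \<union> {b \<in> blocks (Suc n). c \<in> X b})"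
    by (rule card_Un_disjoint[symmetric]) (auto simp: complement_cover_def)
  also have "{b \<in> blocks (Suc n). c \<in> complement_cover (Suc n) X b} \<union> {b \<in> blocks (Suc n). c \<in> X b} =
    {b \<in> blocks (Suc n). c \<in> block b}"
    using assms by (auto simp: complement_cover_def)
  finally show ?thesis by (simp add: card_blocks_containing)
qed

lemma complement_complement:
  assumes "X \<in> covers m A" shows "complement_cover m (complement_cover m X) = X"
proof
  fix b show "complement_cover m (complement_cover m X) b = X b"
    using coversD(1)[OF assms, of b] extensional_arb[OF coversD(5)[OF assms], of b]
    by (simp add: complement_cover_def double_diff)
qed

text \<open>
By \<open>card_blocks_containing\<close> the multiplicities of a cell in a family of parts and in the
complementary family add up to its membership counts in the two diamonds.
\<close>

lemma bij_betw_complement: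
  "bij_betw (complement_cover (Suc n)) (covers (Suc n) (aztec_diamond n)) (covers (Suc n) (aztec_diamond (Suc n)))"
proof (rule bij_betw_byWitness[where f' = "complement_cover (Suc n)"])
  have ext: "complement_cover (Suc n) X \<in> PiE (blocks (Suc n)) (\<lambda>b. Pow (block b))" for X
    by (auto simp: complement_cover_def)
  have "complement_cover (Suc n) X \<in> covers (Suc n) A'"
    if X: "X \<in> covers (Suc n) A" and A: "{A, A'} = {aztec_diamond n, aztec_diamond (Suc n)}" for X A A'
  proof -
    have "card {b \<in> blocks (Suc n). c \<in> complement_cover (Suc n) X b} = of_bool (c \<in> A')" for c
    proof -
      have "card {b \<in> blocks (Suc n). c \<in> X b} = of_bool (c \<in> A)"
        using X unfolding covers_def by blast
      moreover have "A = aztec_diamond n \<and> A' = aztec_diamond (Suc n) \<or> A = aztec_diamond (Suc n) \<and> A' = aztec_diamond n"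
        using A by (simp add: doubleton_eq_iff)
      ultimately show ?thesis
        using card_complement_cover[of n X c, OF coversD(1)[OF X]] by (elim disjE conjE) simp_all
    qed
    thus ?thesis using ext unfolding covers_def by blast
  qed
  thus "complement_cover (Suc n) ` covers (Suc n) (aztec_diamond n) \<subseteq> covers (Suc n) (aztec_diamond (Suc n))"
    "complement_cover (Suc n) ` covers (Suc n) (aztec_diamond (Suc n)) \<subseteq> covers (Suc n) (aztec_diamond n)"
    by (blast, blast)
qed (auto simp: complement_complement)

lemma sum_card_cover:
  assumes "X \<in> covers m A" "finite A"
  shows "(\<Sum>b\<in>blocks m. card (X b)) = card A"
proof -
  have "A = (\<Union>b\<in>blocks m. X b)" using coversD(2,3)[OF assms(1)] by blast
  thus ?thesis
    using coversD(2)[OF assms(1)] coversD(4)[OF assms(1)] assms(2)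
    by (subst card_UN_disjoint[symmetric]) (auto intro: finite_subset)
qed

lemma cover_weight_complement:
  assumes X: "X \<in> covers m A" "finite A"
  shows "cover_weight m (complement_cover m X) * sqrt 2 ^ card A = 2 ^ card (blocks m) * cover_weight m X"
proof -
  have "cover_weight m (complement_cover m X) * sqrt 2 ^ card A
     = (\<Prod>b\<in>blocks m. num_fillings (block b - X b)) * (\<Prod>b\<in>blocks m. sqrt 2 ^ card (X b))"
    by (simp add: cover_weight_def complement_cover_def sum_card_cover[OF X, symmetric] power_sum)
  also have "\<dots> = (\<Prod>b\<in>blocks m. num_fillings (block b - X b) * sqrt 2 ^ card (X b))"
    by (simp add: prod.distrib)
  also have "\<dots> = (\<Prod>b\<in>blocks m. 2 * num_fillings (X b))"
    by (rule prod.cong) (use coversD(1)[OF X(1)] num_fillings_complement in auto)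
  also have "\<dots> = 2 ^ card (blocks m) * cover_weight m X"
    by (simp add: prod.distrib cover_weight_def)
  finally show ?thesis .
qed

definition domino_probability :: "nat \<Rightarrow> cell set \<Rightarrow> real" where
  "domino_probability n d = real (card {T \<in> aztec_tilings n. d \<in> T}) / real (card (aztec_tilings n))"

lemma tilings_0: "aztec_tilings 0 = {{}}"
proof -
  have "(i, j) \<notin> aztec_diamond 0" for i j unfolding mem_aztec by presburger
  hence "aztec_diamond 0 = {}" by auto
  thus ?thesis by (auto simp: aztec_tilings_def partition_on_empty)
qed

lemma blocks_Suc_nonempty: "\<exists>b. b \<in> blocks (Suc n)"
  by (rule exI[of _ "(int n, 0)"]) (simp add: blocks_def)

text \<open>
Hence complementation carries the uniform distribution on the tilings of one diamond to that of the
next, as far as the covers are concerned.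
\<close>

lemma complement_count:
  obtains K where "K > 0" "\<And>X. X \<in> covers (Suc n) (aztec_diamond n) \<Longrightarrow>
     cover_weight (Suc n) (complement_cover (Suc n) X) = K * cover_weight (Suc n) X"
proof (rule that[of "2 ^ card (blocks (Suc n)) / sqrt 2 ^ card (aztec_diamond n)"])
  fix X assume "X \<in> covers (Suc n) (aztec_diamond n)"
  from cover_weight_complement[OF this]
  show "cover_weight (Suc n) (complement_cover (Suc n) X) =
    2 ^ card (blocks (Suc n)) / sqrt 2 ^ card (aztec_diamond n) * cover_weight (Suc n) X"
    by (simp add: field_simps)
qed simp

lemma tilings_Suc:
  assumes "\<And>X. X \<in> covers (Suc n) (aztec_diamond n) \<Longrightarrow>
     cover_weight (Suc n) (complement_cover (Suc n) X) = K * cover_weight (Suc n) X"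
  shows "real (card (aztec_tilings (Suc n))) = K * real (card (aztec_tilings n))"
proof -
  obtain b where b: "b \<in> blocks (Suc n)" using blocks_Suc_nonempty by blast
  have "real (card (aztec_tilings (Suc n))) = (\<Sum>X\<in>covers (Suc n) (aztec_diamond (Suc n)). cover_weight (Suc n) X)"
    by (rule card_tilings[OF _ b]) simp
  also have "\<dots> = (\<Sum>X\<in>covers (Suc n) (aztec_diamond n). cover_weight (Suc n) (complement_cover (Suc n) X))"
    by (rule sum.reindex_bij_betw[OF bij_betw_complement, symmetric])
  also have "\<dots> = (\<Sum>X\<in>covers (Suc n) (aztec_diamond n). K * cover_weight (Suc n) X)"
    by (rule sum.cong) (use assms in auto)
  also have "\<dots> = K * real (card (aztec_tilings n))"
    by (simp add: sum_distrib_left card_tilings[OF _ b, of n])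
  finally show ?thesis .
qed

lemma tilings_nonempty: "aztec_tilings n \<noteq> {}"
proof (induction n)
  case 0 show ?case by (simp add: tilings_0)
next
  case (Suc n)
  obtain K where K: "K > 0" "\<And>X. X \<in> covers (Suc n) (aztec_diamond n) \<Longrightarrow>
     cover_weight (Suc n) (complement_cover (Suc n) X) = K * cover_weight (Suc n) X"
    using complement_count by blast
  have "card (aztec_tilings n) > 0" using Suc by (simp add: card_gt_0_iff)
  hence "real (card (aztec_tilings (Suc n))) > 0" using tilings_Suc[OF K(2)] K(1) by simp
  thus ?case by auto
qed

lemma sum_average:
  fixes a w :: "'a \<Rightarrow> real"
  shows "(\<Sum>x\<in>C. K * (a x + (w x - (\<Sum>y\<in>S. g x y)) / 2)) =
    K * ((\<Sum>x\<in>C. a x) + ((\<Sum>x\<in>C. w x) - (\<Sum>y\<in>S. \<Sum>x\<in>C. g x y)) / 2)"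
proof -
  have "(\<Sum>y\<in>S. \<Sum>x\<in>C. g x y) = (\<Sum>x\<in>C. \<Sum>y\<in>S. g x y)" by (rule sum.swap)
  thus ?thesis
    by (simp only: sum_distrib_left[symmetric] sum.distrib sum_divide_distrib[symmetric] sum_subtractf)
qed

text \<open>
Let \<open>X\<close> be the random part of the block \<open>b\<close> that a tiling of the smaller diamond covers. In the
smaller diamond \<open>d\<close> has probability \<open>P(X = d) + P(X = b) / 2\<close>, in the larger one
\<open>P(X = b - d) + P(X = {}) / 2\<close>, and the sum of the first expression over the four sides is
\<open>1 + P(X = b) - P(X = {})\<close>.
\<close>

theorem shuffling_recurrence:
  assumes b: "b \<in> blocks (Suc n)" and d: "d \<in> sides b"
  shows "domino_probability (Suc n) d =
    domino_probability n (block b - d) + (1 - (\<Sum>d'\<in>sides b. domino_probability n d')) / 2"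
proof -
  let ?C = "covers (Suc n) (aztec_diamond n)"
  let ?w = "cover_weight (Suc n)"
  obtain K where K: "K > 0" "\<And>X. X \<in> ?C \<Longrightarrow> ?w (complement_cover (Suc n) X) = K * ?w X"
    using complement_count by blast
  define t where "t = real (card (aztec_tilings n))"
  have t: "t > 0" using tilings_nonempty by (simp add: t_def card_gt_0_iff)
  have t_sum: "t = (\<Sum>X\<in>?C. ?w X)" unfolding t_def by (rule card_tilings[OF _ b]) simp
  have old: "t * domino_probability n d' = (\<Sum>X\<in>?C. ?w X * (of_bool (X b = d') + of_bool (X b = block b) / 2))"
    if "d' \<in> sides b" for d'
    using card_tilings_containing[OF _ b that, of n] tilings_nonempty[of n] by (simp add: domino_probability_def t_def)
  have "K * t * domino_probability (Suc n) d = real (card {T \<in> aztec_tilings (Suc n). d \<in> T})"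
    using t K(1) tilings_Suc[OF K(2)] tilings_nonempty[of n] tilings_nonempty[of "Suc n"]
    by (simp add: domino_probability_def t_def)
  also have "\<dots> = (\<Sum>X\<in>covers (Suc n) (aztec_diamond (Suc n)).
      ?w X * (of_bool (X b = d) + of_bool (X b = block b) / 2))"
    by (rule card_tilings_containing[OF _ b d]) simp
  also have "\<dots> = (\<Sum>X\<in>?C. ?w (complement_cover (Suc n) X) *
      (of_bool (complement_cover (Suc n) X b = d) + of_bool (complement_cover (Suc n) X b = block b) / 2))"
    by (rule sum.reindex_bij_betw[OF bij_betw_complement, symmetric])
  also have "\<dots> = (\<Sum>X\<in>?C. K * (?w X * (of_bool (X b = block b - d) + of_bool (X b = block b) / 2) +
      (?w X - (\<Sum>d'\<in>sides b. ?w X * (of_bool (X b = d') + of_bool (X b = block b) / 2))) / 2))"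
  proof (rule sum.cong[OF refl])
    fix X assume X: "X \<in> ?C"
    have sub: "X b \<subseteq> block b" by (rule coversD(1)[OF X b])
    have iff: "complement_cover (Suc n) X b = Y \<longleftrightarrow> X b = block b - Y" if "Y \<subseteq> block b" for Y
      using b sub that by (auto simp: complement_cover_def)
    have four: "(\<Sum>d'\<in>sides b. f d') = f (top_of b) + f (bottom_of b) + f (left_of b) + f (right_of b)"
      for f :: "cell set \<Rightarrow> real"
      by (simp add: sides_def sides_neq)
    have balance: "w * of_bool (X b = {}) = w * of_bool (X b = block b) +
        (w - (\<Sum>d'\<in>sides b. w * (of_bool (X b = d') + of_bool (X b = block b) / 2)))"
      if w: "w = ?w X" for w
      using sub
    proof (cases rule: side_cases)
      case 1
      show ?thesis unfolding four 1 by (simp add: sides_neq sides_neq[symmetric])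
    next
      case 2
      show ?thesis unfolding four 2 by (simp add: sides_neq sides_neq[symmetric])
    next
      case 3
      have "X b = top_of b \<or> X b = bottom_of b \<or> X b = left_of b \<or> X b = right_of b"
        using 3 by (simp add: sides_def)
      thus ?thesis unfolding four by (elim disjE) (simp_all add: sides_neq sides_neq[symmetric])
    next
      case 4
      hence "w = 0" unfolding w by (simp add: cover_weight_remove[OF b] num_fillings_def)
      thus ?thesis by simp
    qed
    have key: "?w X * (of_bool (X b = block b - d) + of_bool (X b = {}) / 2) =
      ?w X * (of_bool (X b = block b - d) + of_bool (X b = block b) / 2) +
      (?w X - (\<Sum>d'\<in>sides b. ?w X * (of_bool (X b = d') + of_bool (X b = block b) / 2))) / 2"
    proof -
      have "w * (p + e / 2) = w * (p + f / 2) + (w - S) / 2" if "w * e = w * f + (w - S)" for w p e f S :: real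
      proof -
        have S: "w - S = w * e - w * f" using that by simp
        show ?thesis unfolding S by (simp add: distrib_left diff_divide_distrib)
      qed
      from this[OF balance[OF refl]] show ?thesis .
    qed
    have c: "complement_cover (Suc n) X b = d \<longleftrightarrow> X b = block b - d"
      "complement_cover (Suc n) X b = block b \<longleftrightarrow> X b = {}"
      using iff[OF side_subset[OF d]] iff[of "block b"] by simp_all
    show "?w (complement_cover (Suc n) X) *
      (of_bool (complement_cover (Suc n) X b = d) + of_bool (complement_cover (Suc n) X b = block b) / 2) =
      K * (?w X * (of_bool (X b = block b - d) + of_bool (X b = block b) / 2) +
      (?w X - (\<Sum>d'\<in>sides b. ?w X * (of_bool (X b = d') + of_bool (X b = block b) / 2))) / 2)"
      unfolding c K(2)[OF X] mult.assoc by (simp only: key)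
  qed
  also have "\<dots> = K * ((\<Sum>X\<in>?C. ?w X * (of_bool (X b = block b - d) + of_bool (X b = block b) / 2)) +
      ((\<Sum>X\<in>?C. ?w X) - (\<Sum>d'\<in>sides b. \<Sum>X\<in>?C. ?w X * (of_bool (X b = d') + of_bool (X b = block b) / 2))) / 2)"
    by (rule sum_average)
  also have "\<dots> = K * (t * domino_probability n (block b - d) +
      (t - (\<Sum>d'\<in>sides b. t * domino_probability n d')) / 2)"
    by (simp only: old[OF complement_side[OF d]] t_sum[symmetric] old cong: sum.cong)
  also have "\<dots> = K * t * (domino_probability n (block b - d) + (1 - (\<Sum>d'\<in>sides b. domino_probability n d')) / 2)"
    unfolding sum_distrib_left[symmetric] by (simp add: algebra_simps diff_divide_distrib)
  finally show ?thesis using t K(1) by simp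
qed

lemma domino_probability_outside:
  "\<not> d \<subseteq> aztec_diamond n \<Longrightarrow> domino_probability n d = 0"
proof -
  assume "\<not> d \<subseteq> aztec_diamond n"
  hence "{T \<in> aztec_tilings n. d \<in> T} = {}" using tilingD(2) by blast
  thus ?thesis by (simp add: domino_probability_def)
qed

lemma mem_hor: "(i, j) \<in> horizontal_domino x y \<longleftrightarrow> (x = i \<or> x = i - 1) \<and> y = j"
  by (auto simp: horizontal_domino_def)

lemma mem_ver: "(i, j) \<in> vertical_domino x y \<longleftrightarrow> x = i \<and> (y = j \<or> y = j - 1)"
  by (auto simp: vertical_domino_def)

lemma dominoes_through:
  "d \<in> dominoes \<and> (i, j) \<in> d \<longleftrightarrow> d \<in> {horizontal_domino i j, horizontal_domino (i - 1) j,
     vertical_domino i j, vertical_domino i (j - 1)}"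
proof
  assume "d \<in> dominoes \<and> (i, j) \<in> d"
  then obtain x y where "d = horizontal_domino x y \<and> (i, j) \<in> horizontal_domino x y \<or>
      d = vertical_domino x y \<and> (i, j) \<in> vertical_domino x y"
    unfolding dominoes_def by blast
  thus "d \<in> {horizontal_domino i j, horizontal_domino (i - 1) j, vertical_domino i j, vertical_domino i (j - 1)}"
    unfolding mem_hor mem_ver by (elim disjE conjE) simp_all
next
  assume "d \<in> {horizontal_domino i j, horizontal_domino (i - 1) j, vertical_domino i j, vertical_domino i (j - 1)}"
  hence "d \<in> dominoes" unfolding dominoes_def by auto
  moreover have "(i, j) \<in> d"
    using \<open>d \<in> {_, _, _, _}\<close> by (elim insertE emptyE) (simp_all add: horizontal_domino_def vertical_domino_def)
  ultimately show "d \<in> dominoes \<and> (i, j) \<in> d" by simp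
qed

lemma sum_probability_cell:
  "domino_probability n (horizontal_domino i j) + domino_probability n (horizontal_domino (i - 1) j) +
   domino_probability n (vertical_domino i j) + domino_probability n (vertical_domino i (j - 1)) =
   of_bool ((i, j) \<in> aztec_diamond n)"
proof (cases "(i, j) \<in> aztec_diamond n")
  case False
  thus ?thesis
    by (simp add: domino_probability_outside horizontal_domino_def vertical_domino_def)
next
  case True
  let ?S = "{horizontal_domino i j, horizontal_domino (i - 1) j, vertical_domino i j, vertical_domino i (j - 1)}"
  have "aztec_tilings n = (\<Union>d\<in>?S. {T \<in> aztec_tilings n. d \<in> T})"
  proof (intro equalityI subsetI)
    fix T assume T: "T \<in> aztec_tilings n"
    then obtain d where "d \<in> T" "(i, j) \<in> d" using tilingD(2)[OF T] True by blast
    moreover have "d \<in> ?S" using tilingD(1)[OF T] calculation dominoes_through[of d i j] by blast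
    ultimately show "T \<in> (\<Union>d\<in>?S. {T \<in> aztec_tilings n. d \<in> T})" using T by blast
  qed blast
  hence "card (aztec_tilings n) = card (\<Union>d\<in>?S. {T \<in> aztec_tilings n. d \<in> T})" by simp
  also have "\<dots> = (\<Sum>d\<in>?S. card {T \<in> aztec_tilings n. d \<in> T})"
  proof (rule card_UN_disjoint)
    show "\<forall>d\<in>?S. \<forall>d'\<in>?S. d \<noteq> d' \<longrightarrow> {T \<in> aztec_tilings n. d \<in> T} \<inter> {T \<in> aztec_tilings n. d' \<in> T} = {}"
    proof (intro ballI impI)
      fix d d' assume d: "d \<in> ?S" "d' \<in> ?S" "d \<noteq> d'"
      have "(i, j) \<in> d" "(i, j) \<in> d'"
        using d(1,2) unfolding dominoes_through[symmetric] by simp_all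
      thus "{T \<in> aztec_tilings n. d \<in> T} \<inter> {T \<in> aztec_tilings n. d' \<in> T} = {}"
        using tilingD(3) d(3) by blast
    qed
  qed auto
  also have "\<dots> = card {T \<in> aztec_tilings n. horizontal_domino i j \<in> T} + card {T \<in> aztec_tilings n. horizontal_domino (i - 1) j \<in> T}
     + card {T \<in> aztec_tilings n. vertical_domino i j \<in> T} + card {T \<in> aztec_tilings n. vertical_domino i (j - 1) \<in> T}"
  proof -
    have "horizontal_domino i j \<noteq> horizontal_domino (i - 1) j" "vertical_domino i j \<noteq> vertical_domino i (j - 1)"
      "horizontal_domino x y \<noteq> vertical_domino z w" for x y z w
      by (auto simp: horizontal_domino_def vertical_domino_def doubleton_eq_iff)
    thus ?thesis by simp
  qed
  finally have sum: "real (card (aztec_tilings n)) = real (card {T \<in> aztec_tilings n. horizontal_domino i j \<in> T}) + 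
     real (card {T \<in> aztec_tilings n. horizontal_domino (i - 1) j \<in> T}) +
     real (card {T \<in> aztec_tilings n. vertical_domino i j \<in> T}) + real (card {T \<in> aztec_tilings n. vertical_domino i (j - 1) \<in> T})"
    by simp
  show ?thesis
    unfolding domino_probability_def add_divide_distrib[symmetric] sum[symmetric]
    using True tilings_nonempty[of n] by simp
qed

section \<open>Creation rates and Krawtchouk numbers\<close>

abbreviation "hor_prob n i j \<equiv> domino_probability n (horizontal_domino i j)"
abbreviation "ver_prob n i j \<equiv> domino_probability n (vertical_domino i j)"

definition top_prob :: "nat \<Rightarrow> int \<Rightarrow> int \<Rightarrow> real" where "top_prob n i j = hor_prob n (i - 1) j"
definition bottom_prob :: "nat \<Rightarrow> int \<Rightarrow> int \<Rightarrow> real" where "bottom_prob n i j = hor_prob n (i - 1) (j - 1)"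
definition left_prob :: "nat \<Rightarrow> int \<Rightarrow> int \<Rightarrow> real" where "left_prob n i j = ver_prob n (i - 1) (j - 1)"
definition right_prob :: "nat \<Rightarrow> int \<Rightarrow> int \<Rightarrow> real" where "right_prob n i j = ver_prob n i (j - 1)"

lemmas side_prob_defs = top_prob_def bottom_prob_def left_prob_def right_prob_def

text \<open>
Twice the increase in probability that a domino of the block \<open>(i, j)\<close> gains over the opposite domino
in the previous diamond. It is defined to vanish outside the diamond and at points of the wrong
parity, where the wave equation then holds as well.
\<close>

definition creation :: "nat \<Rightarrow> int \<Rightarrow> int \<Rightarrow> real" where
  "creation n i j = (if (i, j) \<in> blocks n then 1 - (top_prob (n - 1) i j + bottom_prob (n - 1) i j +
      left_prob (n - 1) i j + right_prob (n - 1) i j) else 0)"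

lemma hor_inside:
  assumes "horizontal_domino (i - 1) y \<subseteq> aztec_diamond n" "y = j \<or> y = j - 1"
  shows "\<bar>i\<bar> + \<bar>j\<bar> \<le> int n"
proof -
  have "max (i - 1 + 1) (- (i - 1)) + max (y + 1) (- y) \<le> int n + 1"
    "max (i + 1) (- i) + max (y + 1) (- y) \<le> int n + 1"
    using assms(1) unfolding horizontal_domino_def by (simp_all add: mem_aztec_max)
  thus ?thesis using assms(2) by linarith
qed

lemma ver_inside:
  assumes "vertical_domino x (j - 1) \<subseteq> aztec_diamond n" "x = i \<or> x = i - 1"
  shows "\<bar>i\<bar> + \<bar>j\<bar> \<le> int n"
proof -
  have "max (x + 1) (- x) + max (j - 1 + 1) (- (j - 1)) \<le> int n + 1"
    "max (x + 1) (- x) + max (j + 1) (- j) \<le> int n + 1"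
    using assms(1) unfolding vertical_domino_def by (simp_all add: mem_aztec_max)
  thus ?thesis using assms(2) by linarith
qed

lemma side_prob_outside:
  assumes "int n < \<bar>i\<bar> + \<bar>j\<bar>"
  shows "top_prob n i j = 0" "bottom_prob n i j = 0" "left_prob n i j = 0" "right_prob n i j = 0"
  unfolding side_prob_defs
  using assms hor_inside[of i j n j] hor_inside[of i "j - 1" n j] ver_inside[of "i - 1" j n i] ver_inside[of i j n i]
  by (meson domino_probability_outside not_le)+

lemma mem_blocks_odd:
  "odd (i + j + int n) \<Longrightarrow> (i, j) \<in> blocks n \<longleftrightarrow> \<bar>i\<bar> + \<bar>j\<bar> < int n"
  by (simp add: blocks_def)

lemma mem_blocks_even: "even (i + j + int n) \<Longrightarrow> (i, j) \<notin> blocks n"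
  by (simp add: blocks_def)

lemma norm_neq_odd: "odd (i + j + int n) \<Longrightarrow> \<bar>i\<bar> + \<bar>j\<bar> \<noteq> int n"
  using parity_abs[of i j] by metis

lemma outside_blocks:
  "odd (i + j + int n) \<Longrightarrow> (i, j) \<notin> blocks n \<Longrightarrow> int n < \<bar>i\<bar> + \<bar>j\<bar>"
  using mem_blocks_odd[of i j n] norm_neq_odd[of i j n] by linarith

lemma not_mem_blocks_0: "(i, j) \<notin> blocks 0"
proof -
  have "\<not> \<bar>i\<bar> + \<bar>j\<bar> < int 0" by linarith
  thus ?thesis by (simp add: blocks_def)
qed

lemma side_prob_Suc:
  assumes "odd (i + j + int (Suc n))"
  shows "top_prob (Suc n) i j = bottom_prob n i j + creation (Suc n) i j / 2"
    and "bottom_prob (Suc n) i j = top_prob n i j + creation (Suc n) i j / 2"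
    and "left_prob (Suc n) i j = right_prob n i j + creation (Suc n) i j / 2"
    and "right_prob (Suc n) i j = left_prob n i j + creation (Suc n) i j / 2"
proof -
  have "top_prob (Suc n) i j = bottom_prob n i j + creation (Suc n) i j / 2 \<and>
    bottom_prob (Suc n) i j = top_prob n i j + creation (Suc n) i j / 2 \<and>
    left_prob (Suc n) i j = right_prob n i j + creation (Suc n) i j / 2 \<and>
    right_prob (Suc n) i j = left_prob n i j + creation (Suc n) i j / 2"
  proof (cases "(i, j) \<in> blocks (Suc n)")
    case True
    have d: "top_of (i, j) \<in> sides (i, j)" "bottom_of (i, j) \<in> sides (i, j)"
      "left_of (i, j) \<in> sides (i, j)" "right_of (i, j) \<in> sides (i, j)"
      by (simp_all add: sides_def)
    have p: "top_prob k i j = domino_probability k (top_of (i, j))"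
      "bottom_prob k i j = domino_probability k (bottom_of (i, j))"
      "left_prob k i j = domino_probability k (left_of (i, j))"
      "right_prob k i j = domino_probability k (right_of (i, j))" for k
      by (simp_all add: side_prob_defs top_of_def bottom_of_def left_of_def right_of_def)
    have c: "creation (Suc n) i j = 1 - (\<Sum>d\<in>sides (i, j). domino_probability n d)"
      using True by (simp add: creation_def p sides_def sides_neq)
    show ?thesis
      unfolding p c using d[THEN shuffling_recurrence[OF True]] by (simp add: sides_complement)
  next
    case False
    from outside_blocks[OF assms this] have "int (Suc n) < \<bar>i\<bar> + \<bar>j\<bar>" "int n < \<bar>i\<bar> + \<bar>j\<bar>" by simp_all
    thus ?thesis using False by (simp add: side_prob_outside creation_def)
  qed
  thus "top_prob (Suc n) i j = bottom_prob n i j + creation (Suc n) i j / 2"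
    "bottom_prob (Suc n) i j = top_prob n i j + creation (Suc n) i j / 2"
    "left_prob (Suc n) i j = right_prob n i j + creation (Suc n) i j / 2"
    "right_prob (Suc n) i j = left_prob n i j + creation (Suc n) i j / 2"
    by blast+
qed

lemma creation_Suc:
  assumes "odd (i + j + int (Suc n))"
  shows "creation (Suc n) i j = of_bool ((i, j) \<in> blocks (Suc n)) -
    (top_prob n i j + bottom_prob n i j + left_prob n i j + right_prob n i j)"
proof (cases "(i, j) \<in> blocks (Suc n)")
  case False
  from outside_blocks[OF assms this] have "int n < \<bar>i\<bar> + \<bar>j\<bar>" by simp
  thus ?thesis using False by (simp add: side_prob_outside creation_def)
qed (simp add: creation_def)

lemma sum_block:
  assumes "odd (i + j + int n)"
  shows "top_prob n i j + bottom_prob n i j + left_prob n i j + right_prob n i j =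
    of_bool ((i, j) \<in> blocks n) + creation n i j"
proof (cases n)
  case 0
  have nb: "(i, j) \<notin> blocks n" by (simp add: 0 not_mem_blocks_0)
  from side_prob_outside[OF outside_blocks[OF assms nb]] nb show ?thesis by (simp add: creation_def)
next
  case (Suc k)
  from assms[unfolded Suc] show ?thesis
    unfolding Suc side_prob_Suc[OF assms[unfolded Suc]] creation_Suc[OF assms[unfolded Suc]] by simp
qed

text \<open>
The inhomogeneous terms of the wave equation cancel: away from the boundary both sides are \<open>5\<close>, and
on the outermost lattice points the blocks and the cells that are cut off match.
\<close>

lemma indicator_balance:
  assumes "odd (i + j + int n)"
  shows "of_bool ((i + 1, j) \<in> blocks (Suc n)) + of_bool ((i - 1, j) \<in> blocks (Suc n)) +
    of_bool ((i, j + 1) \<in> blocks (Suc n)) + of_bool ((i, j - 1) \<in> blocks (Suc n)) +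
    of_bool ((i, j) \<in> blocks (Suc (Suc n))) =
    of_bool ((i, j) \<in> aztec_diamond (Suc n)) + of_bool ((i - 1, j) \<in> aztec_diamond (Suc n)) +
    of_bool ((i, j - 1) \<in> aztec_diamond (Suc n)) + of_bool ((i - 1, j - 1) \<in> aztec_diamond (Suc n)) +
    (of_bool ((i, j) \<in> blocks n) :: real)"
proof -
  have mem: "(i + 1, j) \<in> blocks (Suc n) \<longleftrightarrow> \<bar>i + 1\<bar> + \<bar>j\<bar> \<le> int n"
    "(i - 1, j) \<in> blocks (Suc n) \<longleftrightarrow> \<bar>i - 1\<bar> + \<bar>j\<bar> \<le> int n"
    "(i, j + 1) \<in> blocks (Suc n) \<longleftrightarrow> \<bar>i\<bar> + \<bar>j + 1\<bar> \<le> int n"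
    "(i, j - 1) \<in> blocks (Suc n) \<longleftrightarrow> \<bar>i\<bar> + \<bar>j - 1\<bar> \<le> int n"
    "(i, j) \<in> blocks (Suc (Suc n)) \<longleftrightarrow> \<bar>i\<bar> + \<bar>j\<bar> \<le> int n + 1"
    "(i, j) \<in> blocks n \<longleftrightarrow> \<bar>i\<bar> + \<bar>j\<bar> < int n"
    using assms by (auto simp: blocks_def)
  have "\<bar>i\<bar> + \<bar>j\<bar> \<noteq> int n" by (rule norm_neq_odd[OF assms])
  moreover have "\<bar>i\<bar> + \<bar>j\<bar> \<noteq> int n + 2" using norm_neq_odd[of i j "Suc (Suc n)"] assms by simp
  ultimately consider "\<bar>i\<bar> + \<bar>j\<bar> \<ge> int n + 3" | "int n = \<bar>i\<bar> + \<bar>j\<bar> - 1" | "\<bar>i\<bar> + \<bar>j\<bar> \<le> int n - 1"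
    by linarith
  thus ?thesis
  proof cases
    case 1
    hence "\<not> \<bar>i + 1\<bar> + \<bar>j\<bar> \<le> int n" "\<not> \<bar>i - 1\<bar> + \<bar>j\<bar> \<le> int n" "\<not> \<bar>i\<bar> + \<bar>j + 1\<bar> \<le> int n"
      "\<not> \<bar>i\<bar> + \<bar>j - 1\<bar> \<le> int n" "\<not> \<bar>i\<bar> + \<bar>j\<bar> \<le> int n + 1" "\<not> \<bar>i\<bar> + \<bar>j\<bar> < int n"
      "\<not> max (i + 1) (- i) + max (j + 1) (- j) \<le> int n + 2"
      "\<not> max (i - 1 + 1) (- (i - 1)) + max (j + 1) (- j) \<le> int n + 2"
      "\<not> max (i + 1) (- i) + max (j - 1 + 1) (- (j - 1)) \<le> int n + 2"
      "\<not> max (i - 1 + 1) (- (i - 1)) + max (j - 1 + 1) (- (j - 1)) \<le> int n + 2"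
      by linarith+
    thus ?thesis unfolding mem mem_aztec_max by simp
  next
    case 3
    hence "\<bar>i + 1\<bar> + \<bar>j\<bar> \<le> int n" "\<bar>i - 1\<bar> + \<bar>j\<bar> \<le> int n" "\<bar>i\<bar> + \<bar>j + 1\<bar> \<le> int n"
      "\<bar>i\<bar> + \<bar>j - 1\<bar> \<le> int n" "\<bar>i\<bar> + \<bar>j\<bar> \<le> int n + 1" "\<bar>i\<bar> + \<bar>j\<bar> < int n"
      "max (i + 1) (- i) + max (j + 1) (- j) \<le> int n + 2"
      "max (i - 1 + 1) (- (i - 1)) + max (j + 1) (- j) \<le> int n + 2"
      "max (i + 1) (- i) + max (j - 1 + 1) (- (j - 1)) \<le> int n + 2"
      "max (i - 1 + 1) (- (i - 1)) + max (j - 1 + 1) (- (j - 1)) \<le> int n + 2"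
      by linarith+
    thus ?thesis unfolding mem mem_aztec_max by simp
  next
    case 2
    consider "i < 0" "j < 0" | "i < 0" "j = 0" | "i < 0" "j > 0" | "i = 0" "j < 0" 
      | "i = 0" "j > 0" | "i > 0" "j < 0" | "i > 0" "j = 0" | "i > 0" "j > 0"
    proof -
      have "i \<noteq> 0 \<or> j \<noteq> 0" using 2 by auto
      with linorder_less_linear[of i 0] linorder_less_linear[of j 0] that show thesis by blast
    qed
    thus ?thesis
      unfolding mem mem_aztec_max of_nat_Suc 2 by cases (simp_all add: max_def)
  qed
qed

lemma creation_parity: "even (i + j + int n) \<Longrightarrow> creation n i j = 0"
  by (simp add: creation_def mem_blocks_even)

lemma creation_outside: "int n \<le> \<bar>i\<bar> + \<bar>j\<bar> \<Longrightarrow> creation n i j = 0"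
  by (simp add: creation_def blocks_def)

text \<open>
The elimination behind the wave equation: \<open>a\<close>, \<open>b\<close> and \<open>c\<close> are the sums over the inner, leaving and
outer dominoes around a block, and \<open>u\<close> is the sum of the neighbouring creation rates.
\<close>

lemma wave_algebra:
  fixes a b c s u k q v w p :: real
  assumes "a + b + c = s + u" "2 * a + b = k" "c = q + v + u / 2" "w = p - a" "s + p = k + q"
  shows "w + v = u / 2"
  using assms by linarith

text \<open>
The four blocks around \<open>(i, j)\<close> contain sixteen dominoes: the four inner ones of the block \<open>(i, j)\<close>
itself, eight that leave it, and four outer ones. The inner ones determine the next creation rate.
The cells of the block relate the inner to the leaving dominoes, the recurrence reduces the outer
ones to the preceding diamond, and the sum over each block is \<open>1\<close> plus its creation rate.
\<close>

theorem creation_wave: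
  "creation (Suc (Suc n)) i j + creation n i j =
     (creation (Suc n) (i + 1) j + creation (Suc n) (i - 1) j +
      creation (Suc n) i (j + 1) + creation (Suc n) i (j - 1)) / 2"
proof (cases "odd (i + j + int n)")
  case False
  hence "even (i + j + int n)" "even (i + j + int (Suc (Suc n)))" "even (i + 1 + j + int (Suc n))"
    "even (i - 1 + j + int (Suc n))" "even (i + (j + 1) + int (Suc n))" "even (i + (j - 1) + int (Suc n))"
    by presburger+
  from this[THEN creation_parity] show ?thesis by simp
next
  case True
  have odd: "odd (i + 1 + j + int (Suc n))" "odd (i - 1 + j + int (Suc n))"
    "odd (i + (j + 1) + int (Suc n))" "odd (i + (j - 1) + int (Suc n))" "odd (i + j + int (Suc (Suc n)))"
    using True by presburger+
  note far = side_prob_Suc(1)[OF odd(3)] side_prob_Suc(2)[OF odd(4)] side_prob_Suc(3)[OF odd(2)] side_prob_Suc(4)[OF odd(1)]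
  note near = creation_Suc[OF odd(5)]
  note blk = odd(1-4)[THEN sum_block] sum_block[OF True]
  note cells = sum_probability_cell[of "Suc n" i j] sum_probability_cell[of "Suc n" "i - 1" j]
    sum_probability_cell[of "Suc n" i "j - 1"] sum_probability_cell[of "Suc n" "i - 1" "j - 1"]
  have e: "i + 1 - 1 = i" "j + 1 - 1 = j" "i - 1 - 1 = i - 2" "j - 1 - 1 = j - 2" by simp_all
  define inner where "inner = hor_prob (Suc n) (i - 1) j + hor_prob (Suc n) (i - 1) (j - 1) +
    ver_prob (Suc n) (i - 1) (j - 1) + ver_prob (Suc n) i (j - 1)"
  define outward where "outward = hor_prob (Suc n) i j + hor_prob (Suc n) i (j - 1) +
    hor_prob (Suc n) (i - 2) j + hor_prob (Suc n) (i - 2) (j - 1) +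
    ver_prob (Suc n) (i - 1) j + ver_prob (Suc n) i j +
    ver_prob (Suc n) (i - 1) (j - 2) + ver_prob (Suc n) i (j - 2)"
  define outer where "outer = hor_prob (Suc n) (i - 1) (j + 1) + hor_prob (Suc n) (i - 1) (j - 2) +
    ver_prob (Suc n) (i - 2) (j - 1) + ver_prob (Suc n) (i + 1) (j - 1)"
  define u where "u = creation (Suc n) (i + 1) j + creation (Suc n) (i - 1) j +
      creation (Suc n) i (j + 1) + creation (Suc n) i (j - 1)"
  define blks where "blks = (of_bool ((i + 1, j) \<in> blocks (Suc n)) + of_bool ((i - 1, j) \<in> blocks (Suc n)) +
    of_bool ((i, j + 1) \<in> blocks (Suc n)) + of_bool ((i, j - 1) \<in> blocks (Suc n)) :: real)"
  define clls where "clls = (of_bool ((i, j) \<in> aztec_diamond (Suc n)) + of_bool ((i - 1, j) \<in> aztec_diamond (Suc n)) +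
    of_bool ((i, j - 1) \<in> aztec_diamond (Suc n)) + of_bool ((i - 1, j - 1) \<in> aztec_diamond (Suc n)) :: real)"
  have "inner + outward + outer = blks + u"
    using blk(1-4) unfolding side_prob_defs e inner_def outward_def outer_def blks_def u_def by simp
  moreover have "2 * inner + outward = clls"
    using cells unfolding e inner_def outward_def clls_def by simp
  moreover have "outer = of_bool ((i, j) \<in> blocks n) + creation n i j + u / 2"
    unfolding blk(5)[symmetric] outer_def u_def using far unfolding side_prob_defs e by simp
  moreover have "creation (Suc (Suc n)) i j = of_bool ((i, j) \<in> blocks (Suc (Suc n))) - inner"
    using near unfolding side_prob_defs inner_def by simp
  moreover have "blks + of_bool ((i, j) \<in> blocks (Suc (Suc n))) = clls + of_bool ((i, j) \<in> blocks n)"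
    using indicator_balance[OF True] unfolding blks_def clls_def by simp
  ultimately have "creation (Suc (Suc n)) i j + creation n i j = u / 2" by (rule wave_algebra)
  thus ?thesis by (simp only: u_def)
qed

corollary creation_step:
  "creation (Suc (Suc n)) i j = (creation (Suc n) (i + 1) j + creation (Suc n) (i - 1) j +
      creation (Suc n) i (j + 1) + creation (Suc n) i (j - 1)) / 2 - creation n i j"
  unfolding creation_wave[symmetric] by simp

lemma creation_0 [simp]: "creation 0 i j = 0"
  by (simp add: creation_def not_mem_blocks_0)

lemma creation_1: "creation (Suc 0) i j = of_bool (i = 0 \<and> j = 0)"
proof (cases "i = 0 \<and> j = 0")
  case True
  have "top_prob 0 0 0 = 0" "bottom_prob 0 0 0 = 0" "left_prob 0 0 0 = 0" "right_prob 0 0 0 = 0"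
    unfolding side_prob_defs
    by (simp_all add: domino_probability_outside horizontal_domino_def vertical_domino_def mem_aztec)
  thus ?thesis using True by (simp add: creation_def blocks_def)
next
  case False
  hence "(i, j) \<notin> blocks (Suc 0)" by (auto simp: blocks_def)
  thus ?thesis using False by (simp add: creation_def)
qed

lemma creation_symmetric: "creation n i j = creation n j i \<and> creation n (- i) j = creation n i j"
proof (induction n arbitrary: i j rule: less_induct)
  case (less n)
  consider "n = 0" | "n = Suc 0" | m where "n = Suc (Suc m)" by (metis not0_implies_Suc)
  thus ?case
  proof cases
    case 3
    have lt: "m < n" "Suc m < n" using 3 by simp_all
    have swap: "creation m i j = creation m j i" "creation (Suc m) i j = creation (Suc m) j i" for i j
      by (fact less[OF lt(1), THEN conjunct1] less[OF lt(2), THEN conjunct1])+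
    have neg: "creation m (- i) j = creation m i j" "creation (Suc m) (- i) j = creation (Suc m) i j" for i j
      by (fact less[OF lt(1), THEN conjunct2] less[OF lt(2), THEN conjunct2])+
    have "creation (Suc m) (- i + 1) j = creation (Suc m) (i - 1) j"
      "creation (Suc m) (- i - 1) j = creation (Suc m) (i + 1) j"
      using neg(2)[of "i - 1" j] neg(2)[of "i + 1" j] by simp_all
    hence "creation n (- i) j = creation n i j"
      unfolding 3 creation_step[of m "- i" j] creation_step[of m i j] neg by simp
    moreover have "creation n i j = creation n j i"
      unfolding 3 creation_step[of m i j] creation_step[of m j i] swap(1)[of i j]
        swap(2)[of "i + 1" j] swap(2)[of "i - 1" j] swap(2)[of i "j + 1"] swap(2)[of i "j - 1"] by simp
    ultimately show ?thesis by simp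
  qed (auto simp: creation_1)
qed

lemmas creation_swap = creation_symmetric[THEN conjunct1]
lemmas creation_neg = creation_symmetric[THEN conjunct2]

lemma creation_neg2: "creation n i (- j) = creation n i j"
  using creation_neg[of n j i] creation_swap[of n i "- j"] creation_swap[of n i j] by simp

lemma creation_abs: "creation n i j = creation n \<bar>i\<bar> \<bar>j\<bar>"
  using creation_neg[of n i] creation_neg2[of n _ j] by (auto simp: abs_if)

text \<open>
At the outermost points the wave equation degenerates to Pascal's rule.
\<close>

lemma creation_boundary:
  "creation (Suc (a + b)) (int a) (int b) = real ((a + b) choose a) / 2 ^ (a + b)"
proof (induction "a + b" arbitrary: a b)
  case 0
  thus ?case by (simp add: creation_1)
next
  case (Suc n)
  have n: "a + b = Suc n" using Suc(2) by simp
  have out: "creation n (int a) (int b) = 0" "creation (Suc n) (int a + 1) (int b) = 0"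
    "creation (Suc n) (int a) (int b + 1) = 0"
    using n by (auto intro!: creation_outside)
  have L: "creation (Suc n) (int a - 1) (int b) = (if a = 0 then 0 else real (n choose (a - 1)) / 2 ^ n)"
  proof (cases a)
    case 0
    thus ?thesis using n by (simp add: creation_outside)
  next
    case (Suc a')
    thus ?thesis using Suc.hyps(1)[of a' b] n by simp
  qed
  have R: "creation (Suc n) (int a) (int b - 1) = (if b = 0 then 0 else real (n choose a) / 2 ^ n)"
  proof (cases b)
    case 0
    thus ?thesis using n by (simp add: creation_outside)
  next
    case (Suc b')
    thus ?thesis using Suc.hyps(1)[of a b'] n by simp
  qed
  have "creation (Suc (Suc n)) (int a) (int b) =
    (creation (Suc n) (int a - 1) (int b) + creation (Suc n) (int a) (int b - 1)) / 2"
    using creation_wave[of n "int a" "int b"] out by simp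
  also have "\<dots> = real (Suc n choose a) / 2 ^ Suc n"
  proof (cases a)
    case 0
    show ?thesis unfolding L R using 0 n by simp
  next
    case (Suc a')
    have "b = 0 \<Longrightarrow> n choose a = 0" using n by simp
    thus ?thesis unfolding L R using Suc by (auto simp: add_divide_distrib binomial_eq_0)
  qed
  finally show ?case by (simp add: n)
qed

definition krawtchouk :: "nat \<Rightarrow> nat \<Rightarrow> nat \<Rightarrow> int" where
  "krawtchouk a b x = coeff ([:1, 1:] ^ a * [:1, - 1:] ^ b) x"

lemma coeff_times_plus: "coeff ([:1, 1:] * p) (Suc x) = coeff p (Suc x) + (coeff p x :: int)"
  by (simp add: mult_pCons_left coeff_pCons)

lemma coeff_times_minus: "coeff ([:1, - 1:] * p) (Suc x) = coeff p (Suc x) - (coeff p x :: int)"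
  by (simp add: mult_pCons_left coeff_pCons)

lemma krawtchouk_plus: "krawtchouk (Suc a) b (Suc x) = krawtchouk a b (Suc x) + krawtchouk a b x"
  unfolding krawtchouk_def power_Suc mult.assoc by (rule coeff_times_plus)

lemma krawtchouk_minus: "krawtchouk a (Suc b) (Suc x) = krawtchouk a b (Suc x) - krawtchouk a b x"
proof -
  have "[:1, 1:] ^ a * [:1, - 1:] ^ Suc b = [:1, - 1:] * ([:1, 1:] ^ a * [:1, - 1:] ^ b :: int poly)"
    by (simp only: power_Suc mult.left_commute)
  thus ?thesis unfolding krawtchouk_def using coeff_times_minus by simp
qed

lemma krawtchouk_0: "krawtchouk a b 0 = 1"
  by (simp add: krawtchouk_def coeff_mult coeff_0_power)

lemma krawtchouk_binomial: "krawtchouk a 0 x = int (a choose x)"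
proof (induction a arbitrary: x)
  case 0
  show ?case by (cases x) (simp_all add: krawtchouk_def)
next
  case (Suc a)
  show ?case by (cases x) (simp_all add: krawtchouk_0 krawtchouk_plus Suc)
qed

lemma krawtchouk_binomial_minus: "krawtchouk 0 b x = (- 1) ^ x * int (b choose x)"
proof (induction b arbitrary: x)
  case 0
  show ?case by (cases x) (simp_all add: krawtchouk_def)
next
  case (Suc b)
  show ?case by (cases x) (simp_all add: krawtchouk_0 krawtchouk_minus Suc algebra_simps)
qed

lemma krawtchouk_top: "krawtchouk a b (a + b) = (- 1) ^ b"
proof -
  have "degree ([:1, 1:] ^ a * [:1, - 1:] ^ b :: int poly) = a + b"
    by (simp add: degree_mult_eq degree_power_eq)
  hence "krawtchouk a b (a + b) = lead_coeff ([:1, 1:] ^ a * [:1, - 1:] ^ b :: int poly)"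
    by (simp add: krawtchouk_def)
  thus ?thesis by (simp add: lead_coeff_mult lead_coeff_power)
qed

text \<open>
Both factors satisfy the same contiguity relations, which come from multiplication by
\<open>1 + z\<close> and \<open>1 - z\<close>; the wave equation for the product is a formal consequence of them.
\<close>

lemma krawtchouk_product_wave:
  "krawtchouk (Suc y') (Suc y) (Suc x) * krawtchouk (Suc x') (Suc x) (Suc y) +
     4 * (krawtchouk y' y x * krawtchouk x' x y) =
   krawtchouk y' (Suc y) (Suc x) * krawtchouk x' (Suc x) (Suc y) +
   krawtchouk (Suc y') y (Suc x) * krawtchouk x' (Suc x) y +
   krawtchouk y' (Suc y) x * krawtchouk (Suc x') x (Suc y) +
   krawtchouk (Suc y') y x * krawtchouk (Suc x') x y"
proof -
  let ?k = krawtchouk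
  have 1: "?k (Suc y') (Suc y) (Suc x) = ?k y' (Suc y) (Suc x) + ?k y' (Suc y) x"
    "?k (Suc x') (Suc x) (Suc y) = ?k x' (Suc x) (Suc y) + ?k x' (Suc x) y"
    by (rule krawtchouk_plus)+
  have 2: "?k (Suc y') y (Suc x) = ?k y' (Suc y) (Suc x) + 2 * ?k y' y x"
    "?k (Suc x') x (Suc y) = ?k x' (Suc x) (Suc y) + 2 * ?k x' x y"
    by (simp_all add: krawtchouk_plus krawtchouk_minus)
  have "?k (Suc y') y x = 2 * ?k y' y x - ?k y' (Suc y) x" for y' y x
    by (cases x) (simp_all add: krawtchouk_0 krawtchouk_plus krawtchouk_minus)
  note 3 = this[of y' y x] this[of x' x y]
  show ?thesis unfolding 1 2 3 by (simp add: algebra_simps)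
qed

text \<open>
The parameters are the distances of the block from the four sides of the diamond. If one of them is zero, the product
is a binomial coefficient and the value is one of \<open>creation_boundary\<close>; otherwise both sides satisfy
the same wave equation.
\<close>

theorem creation_krawtchouk:
  assumes "x + x' = N" "y + y' = N"
  shows "creation (Suc N) (int x - int y') (int x - int y) =
    real_of_int (krawtchouk y' y x * krawtchouk x' x y) / 2 ^ N"
  using assms
proof (induction N arbitrary: x x' y y' rule: less_induct)
  case (less N)
  note xy = less.prems
  have bd: "creation (Suc N) (int x - int y') (int x - int y) = real (N choose a) / 2 ^ N"
    if "a + b = N" "\<bar>int x - int y'\<bar> = int a" "\<bar>int x - int y\<bar> = int b" for a b
    using creation_boundary[of a b] that by (subst creation_abs) simp
  have sgn: "(- 1) ^ k * ((- 1) ^ k * c) = (c :: int)" for k c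
    by (simp add: mult.assoc[symmetric] power_mult_distrib[symmetric])
  consider "x = 0" | "x' = 0" | "y = 0" | "y' = 0"
    | x1 x1' y1 y1' where "x = Suc x1" "x' = Suc x1'" "y = Suc y1" "y' = Suc y1'"
    by (metis not0_implies_Suc)
  thus ?case
  proof cases
    case 1
    hence "krawtchouk y' y x * krawtchouk x' x y = int (N choose y)"
      using xy by (simp add: krawtchouk_0 krawtchouk_binomial)
    moreover have "N choose y = N choose y'" unfolding xy(2)[symmetric] using binomial_symmetric[of y "y + y'"] by simp
    ultimately show ?thesis using bd[of y' y] 1 xy by simp
  next
    case 2
    hence "x = y' + y" using xy by simp
    hence "krawtchouk y' y x = (- 1) ^ y" by (simp only: krawtchouk_top)
    hence "krawtchouk y' y x * krawtchouk x' x y = int (N choose y)"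
      using xy 2 by (simp add: krawtchouk_binomial_minus sgn)
    thus ?thesis using bd[of y y'] 2 xy by simp
  next
    case 3
    hence "krawtchouk y' y x * krawtchouk x' x y = int (N choose x)"
      using xy by (simp add: krawtchouk_0 krawtchouk_binomial)
    moreover have "N choose x = N choose x'" unfolding xy(1)[symmetric] using binomial_symmetric[of x "x + x'"] by simp
    ultimately show ?thesis using bd[of x' x] 3 xy by simp
  next
    case 4
    hence "y = x' + x" using xy by simp
    hence "krawtchouk x' x y = (- 1) ^ x" by (simp only: krawtchouk_top)
    hence "krawtchouk y' y x * krawtchouk x' x y = int (N choose x)"
      using xy 4 by (simp add: krawtchouk_binomial_minus sgn mult.commute[of "(- 1) ^ x * int (N choose x)"])
    thus ?thesis using bd[of x x'] 4 xy by simp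
  next
    case 5
    obtain M where N: "N = Suc (Suc M)" and M: "x1 + x1' = M" "y1 + y1' = M" using 5 xy by auto
    define i j where "i = int x - int y'" and "j = int x - int y"
    let ?K = "\<lambda>x x' y y'. real_of_int (krawtchouk y' y x * krawtchouk x' x y)"
    have 0: "creation (Suc M) i j = ?K x1 x1' y1 y1' / 2 ^ M"
      using less.IH[of M x1 x1' y1 y1'] M N by (simp add: i_def j_def 5)
    have s: "creation (Suc (Suc M)) (int a - int b') (int a - int b) = ?K a a' b b' / 2 ^ Suc M"
      if "a + a' = Suc M" "b + b' = Suc M" for a a' b b'
      using less.IH[of "Suc M" a a' b b'] that N by simp
    have 1: "creation (Suc (Suc M)) (i + 1) j = ?K x x1' y y1' / 2 ^ Suc M"
      using s[of x x1' y y1'] M by (simp add: i_def j_def 5 algebra_simps)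
    have 2: "creation (Suc (Suc M)) (i - 1) j = ?K x1 x' y1 y' / 2 ^ Suc M"
      using s[of x1 x' y1 y'] M by (simp add: i_def j_def 5 algebra_simps)
    have 3: "creation (Suc (Suc M)) i (j + 1) = ?K x x1' y1 y' / 2 ^ Suc M"
      using s[of x x1' y1 y'] M by (simp add: i_def j_def 5 algebra_simps)
    have 4: "creation (Suc (Suc M)) i (j - 1) = ?K x1 x' y y1' / 2 ^ Suc M"
      using s[of x1 x' y y1'] M by (simp add: i_def j_def 5 algebra_simps)
    have id: "?K x x' y y' + 4 * ?K x1 x1' y1 y1' = ?K x x1' y y1' + ?K x x1' y1 y' + ?K x1 x' y y1' + ?K x1 x' y1 y'"
      unfolding 5 using krawtchouk_product_wave[of y1' y1 x1 x1', THEN arg_cong[of _ _ real_of_int]]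
      by simp
    have "creation (Suc N) i j = (?K x x1' y y1' / 2 ^ Suc M + ?K x1 x' y1 y' / 2 ^ Suc M +
       ?K x x1' y1 y' / 2 ^ Suc M + ?K x1 x' y y1' / 2 ^ Suc M) / 2 - ?K x1 x1' y1 y1' / 2 ^ M"
      unfolding N by (subst creation_step) (simp only: 0 1 2 3 4)
    also have "\<dots> = (?K x x1' y y1' + ?K x x1' y1 y' + ?K x1 x' y y1' + ?K x1 x' y1 y' - 4 * ?K x1 x1' y1 y1') / 2 ^ N"
      by (simp add: N field_simps)
    also have "\<dots> = ?K x x' y y' / 2 ^ N" unfolding id[symmetric] add_diff_cancel_right' ..
    finally show ?thesis by (simp add: i_def j_def)
  qed
qed

text \<open>
The recurrences for the four sides are images of each other under the symmetries of the square, and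
creation rates are invariant under them.
\<close>

lemma side_prob_symmetric:
  assumes "odd (i + j + int n)"
  shows "bottom_prob n i j = top_prob n i (- j) \<and> left_prob n i j = top_prob n j (- i) \<and>
    right_prob n i j = top_prob n j i"
  using assms
proof (induction n arbitrary: i j)
  case 0
  have out: "aztec_diamond 0 = {}" using mem_aztec[of _ _ 0] by auto presburger
  have "domino_probability 0 (horizontal_domino a b) = 0" "domino_probability 0 (vertical_domino a b) = 0" for a b
    by (simp_all add: domino_probability_outside horizontal_domino_def vertical_domino_def out)
  thus ?case by (simp add: side_prob_defs)
next
  case (Suc n)
  have odd: "odd (i + - j + int (Suc n))" "odd (j + - i + int (Suc n))" "odd (j + i + int (Suc n))"
    using Suc.prems by presburger+
  have T: "top_prob (Suc n) a b = top_prob n a (b - 1) + creation (Suc n) a b / 2"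
    if "odd (a + b + int (Suc n))" for a b
    using side_prob_Suc(1)[OF that] by (simp add: top_prob_def bottom_prob_def)
  have B: "bottom_prob (Suc n) i j = bottom_prob n i (j + 1) + creation (Suc n) i j / 2"
    using side_prob_Suc(2)[OF Suc.prems] by (simp add: top_prob_def bottom_prob_def)
  have L: "left_prob (Suc n) i j = left_prob n (i + 1) j + creation (Suc n) i j / 2"
    using side_prob_Suc(3)[OF Suc.prems] by (simp add: left_prob_def right_prob_def)
  have R: "right_prob (Suc n) i j = right_prob n (i - 1) j + creation (Suc n) i j / 2"
    using side_prob_Suc(4)[OF Suc.prems] by (simp add: left_prob_def right_prob_def)
  have IH: "bottom_prob n i (j + 1) = top_prob n i (- j - 1)" "left_prob n (i + 1) j = top_prob n j (- i - 1)"
    "right_prob n (i - 1) j = top_prob n j (i - 1)"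
  proof -
    have "odd (i + (j + 1) + int n)" "odd (i + 1 + j + int n)" "odd (i - 1 + j + int n)"
      using Suc.prems by presburger+
    from this[THEN Suc.IH] show "bottom_prob n i (j + 1) = top_prob n i (- j - 1)"
      "left_prob n (i + 1) j = top_prob n j (- i - 1)" "right_prob n (i - 1) j = top_prob n j (i - 1)"
      by simp_all
  qed
  show ?case
    unfolding T[OF odd(1)] T[OF odd(2)] T[OF odd(3)] B L R IH
    using creation_swap[of "Suc n" i j] creation_neg2[of "Suc n" i j] creation_neg2[of "Suc n" j i] by simp
qed

lemma top_prob_iterate:
  assumes "odd (i + j + int n)"
  shows "top_prob (n + k) i (j + int k) = top_prob n i j + (\<Sum>t<k. creation (n + t + 1) i (j + int t + 1)) / 2"
proof (induction k)
  case (Suc k)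
  have "odd (i + (j + int (Suc k)) + int (Suc (n + k)))" using assms by presburger
  from side_prob_Suc(1)[OF this]
  have "top_prob (n + Suc k) i (j + int (Suc k)) = top_prob (n + k) i (j + int k) + creation (n + k + 1) i (j + int k + 1) / 2"
    by (simp add: top_prob_def bottom_prob_def add_ac)
  thus ?case by (simp add: Suc.IH add_divide_distrib)
qed simp

text \<open>
At the centre the four sides of the block are equally likely.
\<close>

lemma top_prob_center: "odd n \<Longrightarrow> top_prob n 0 0 = 1 / 4 + creation n 0 0 / 4"
proof -
  assume n: "odd n"
  hence o: "odd (0 + 0 + int n)" by simp
  have "(0, 0) \<in> blocks n" using n by (auto simp: blocks_def elim: oddE)
  thus ?thesis using sum_block[OF o] side_prob_symmetric[OF o] by simp
qed

text \<open>
The elimination behind \<open>top_prob_axis\<close>: \<open>t\<close>, \<open>p\<close> and \<open>q\<close> are the probabilities of the dominoes in the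
block \<open>(l, 0)\<close>, and \<open>e\<close> and \<open>f\<close> are the values at the centre from which \<open>p\<close> and \<open>q\<close> are reached.
\<close>

lemma axis_algebra:
  fixes t p q c e S f R x y :: real
  assumes "2 * t + p + q = 1 + c" "p = e + S / 2" "f = q + R / 2" "e = 1 / 4 + x / 4" "f = 1 / 4 + y / 4"
  shows "t = 1 / 4 + c / 2 - x / 8 - y / 8 - S / 4 + R / 4"
  using assms by linarith

text \<open>
The block \<open>(0, l)\<close> is reached from the centre of the diamond of size \<open>n - l\<close>, and from \<open>(0, -l)\<close> the centre
of the diamond of size \<open>n + l\<close> is reached, both in \<open>l\<close> steps.
\<close>

theorem top_prob_axis:
  assumes "odd (l + n)" "l < n"
  shows "top_prob n (int l) 0 = 1 / 4 + creation n (int l) 0 / 2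
    - creation (n - l) 0 0 / 8 - creation (n + l) 0 0 / 8
    - (\<Sum>t<l. creation (n - l + t + 1) 0 (int t + 1)) / 4
    + (\<Sum>t<l. creation (n + t + 1) 0 (int t + 1 - int l)) / 4"
proof -
  have o: "odd (int l + 0 + int n)" "odd (0 + 0 + int (n - l))" "odd (0 + (- int l) + int n)"
    using assms by simp_all
  have "(int l, 0) \<in> blocks n" using assms by (simp add: blocks_def)
  hence "2 * top_prob n (int l) 0 + top_prob n 0 (int l) + top_prob n 0 (- int l) = 1 + creation n (int l) 0"
    using sum_block[OF o(1)] side_prob_symmetric[OF o(1)] by simp
  moreover have "top_prob n 0 (int l) = top_prob (n - l) 0 0 + (\<Sum>t<l. creation (n - l + t + 1) 0 (int t + 1)) / 2"
    using top_prob_iterate[OF o(2), of l] assms(2) by simp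
  moreover have "top_prob (n + l) 0 0 = top_prob n 0 (- int l) + (\<Sum>t<l. creation (n + t + 1) 0 (int t + 1 - int l)) / 2"
    using top_prob_iterate[OF o(3), of l] by (simp add: algebra_simps)
  moreover have "top_prob (n - l) 0 0 = 1 / 4 + creation (n - l) 0 0 / 4"
    by (rule top_prob_center) (use assms in simp)
  moreover have "top_prob (n + l) 0 0 = 1 / 4 + creation (n + l) 0 0 / 4"
    by (rule top_prob_center) (use assms in presburger)
  ultimately show ?thesis by (rule axis_algebra)
qed

section \<open>Denominators on the axis\<close>

text \<open>
The square of this polynomial is the polynomial \<open>C\<close> on the axis.
\<close>

definition axis_den :: "nat \<Rightarrow> nat \<Rightarrow> rat poly" where
  "axis_den r s = (\<Prod>i = 1..r. [:of_nat i, 1:]) * (\<Prod>j = 1..s. [:- 2 * of_nat j + 1, 2:])"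

text \<open>
The functions of \<open>p\<close> that eventually equal \<open>binom(2p - 1, p)\<close> times a rational function with
denominator \<open>d\<close>.
\<close>

definition binomial_multiple :: "rat poly \<Rightarrow> (nat \<Rightarrow> rat) \<Rightarrow> bool" where
  "binomial_multiple d F \<longleftrightarrow> (\<exists>G. \<forall>\<^sub>F p in sequentially.
     F p * poly d (of_nat p) = of_nat ((2 * p - 1) choose p) * poly G (of_nat p))"

lemma binomial_multiple_add:
  assumes "binomial_multiple d F" "binomial_multiple d F'"
  shows "binomial_multiple d (\<lambda>p. F p + F' p)"
proof -
  obtain G G' where
    "\<forall>\<^sub>F p in sequentially. F p * poly d (of_nat p) = of_nat ((2 * p - 1) choose p) * poly G (of_nat p)"
    "\<forall>\<^sub>F p in sequentially. F' p * poly d (of_nat p) = of_nat ((2 * p - 1) choose p) * poly G' (of_nat p)"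
    using assms unfolding binomial_multiple_def by blast
  hence "\<forall>\<^sub>F p in sequentially. (F p + F' p) * poly d (of_nat p) =
     of_nat ((2 * p - 1) choose p) * poly (G + G') (of_nat p)"
    by eventually_elim (simp add: algebra_simps)
  thus ?thesis unfolding binomial_multiple_def by blast
qed

lemma binomial_multiple_scale:
  assumes "binomial_multiple d F"
  shows "binomial_multiple d (\<lambda>p. c * F p)"
proof -
  obtain G where
    "\<forall>\<^sub>F p in sequentially. F p * poly d (of_nat p) = of_nat ((2 * p - 1) choose p) * poly G (of_nat p)"
    using assms unfolding binomial_multiple_def by blast
  hence "\<forall>\<^sub>F p in sequentially. (c * F p) * poly d (of_nat p) =
     of_nat ((2 * p - 1) choose p) * poly (smult c G) (of_nat p)"
    by eventually_elim (simp add: mult_ac)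
  thus ?thesis unfolding binomial_multiple_def by blast
qed

lemma binomial_multiple_0: "binomial_multiple d (\<lambda>p. 0)"
  unfolding binomial_multiple_def by (rule exI[of _ 0]) simp

lemma binomial_multiple_sum:
  assumes "\<And>i. i \<in> I \<Longrightarrow> binomial_multiple d (F i)"
  shows "binomial_multiple d (\<lambda>p. \<Sum>i\<in>I. F i p)"
  using assms
  by (induction I rule: infinite_finite_induct)
    (auto simp: binomial_multiple_0 intro!: binomial_multiple_add)

lemma binomial_multiple_cong:
  assumes "binomial_multiple d F" "\<forall>\<^sub>F p in sequentially. F' p = F p"
  shows "binomial_multiple d F'"
proof -
  obtain G where
    "\<forall>\<^sub>F p in sequentially. F p * poly d (of_nat p) = of_nat ((2 * p - 1) choose p) * poly G (of_nat p)"
    using assms(1) unfolding binomial_multiple_def by blast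
  with assms(2) have "\<forall>\<^sub>F p in sequentially. F' p * poly d (of_nat p) = of_nat ((2 * p - 1) choose p) * poly G (of_nat p)"
    by eventually_elim simp
  thus ?thesis unfolding binomial_multiple_def by blast
qed

lemma fact_falling:
  "k \<le> n \<Longrightarrow> (fact n :: rat) = fact (n - k) * (\<Prod>i<k. of_nat n - of_nat i)"
proof (induction k)
  case (Suc k)
  have "n - k = Suc (n - Suc k)" using Suc.prems by simp
  hence "(fact (n - k) :: rat) = of_nat (n - k) * fact (n - Suc k)" by (metis fact_Suc)
  moreover have "(of_nat (n - k) :: rat) = of_nat n - of_nat k" using Suc.prems by (simp add: of_nat_diff)
  ultimately show ?case using Suc by (simp add: mult_ac)
qed simp

text \<open>
The even factors of the falling product of \<open>2x\<close> are doubled factors of the falling product of \<open>x\<close>; the odd ones remain.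
\<close>

lemma falling_double:
  "(\<Prod>i<2 * s + 1. 2 * x - of_nat i) =
     2 ^ (s + 1) * (\<Prod>i<s + 1. x - of_nat i) * (\<Prod>j = 1..s. 2 * x + 1 - 2 * of_nat j)" for x :: rat
proof (induction s)
  case (Suc s)
  have "(\<Prod>i<2 * Suc s + 1. 2 * x - of_nat i) =
    (\<Prod>i<2 * s + 1. 2 * x - of_nat i) * (2 * x - of_nat (2 * s + 1)) * (2 * x - of_nat (2 * s + 2))"
    by (simp add: mult.assoc)
  also have "\<dots> = 2 ^ (Suc s + 1) * (\<Prod>i<Suc s + 1. x - of_nat i) * (\<Prod>j = 1..Suc s. 2 * x + 1 - 2 * of_nat j)"
    unfolding Suc by (simp add: algebra_simps)
  finally show ?case .
qed simp

lemma poly_axis_den: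
  "poly (axis_den r s) x = (\<Prod>i = 1..r. x + of_nat i) * (\<Prod>j = 1..s. 2 * x + 1 - 2 * of_nat j)"
  by (simp add: axis_den_def poly_prod algebra_simps)

lemma central_binomial_fact:
  assumes "p > 0"
  shows "2 * of_nat ((2 * p - 1) choose p) * fact p * fact p = (fact (2 * p) :: rat)"
proof -
  have "2 * ((2 * p - 1) choose p) = (2 * p) choose p"
  proof -
    obtain q where q: "p = Suc q" using assms by (cases p) auto
    have "(2 * p) choose p = ((2 * q + 1) choose q) + ((2 * q + 1) choose Suc q)"
      by (simp add: q)
    moreover have "(2 * q + 1) choose q = (2 * q + 1) choose Suc q"
      using binomial_symmetric[of q "2 * q + 1"] by simp
    moreover have "2 * p - 1 = 2 * q + 1" by (simp add: q)
    ultimately show ?thesis by (simp only: q)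
  qed
  hence "2 * of_nat ((2 * p - 1) choose p) = (of_nat ((2 * p) choose p) :: rat)"
    by (metis of_nat_mult of_nat_numeral)
  thus ?thesis using binomial_fact[of p "2 * p", where 'a = rat] by (simp add: field_simps)
qed

lemma falling_split: "k \<le> m \<Longrightarrow> (\<Prod>i<m. f i) = (\<Prod>i<k. f i) * (\<Prod>i\<in>{k..<m}. f i)" for f :: "nat \<Rightarrow> rat"
  by (metis atLeast0LessThan prod.atLeastLessThan_concat zero_le)

lemma prod_split_upper: "h \<le> r \<Longrightarrow> (\<Prod>i = 1..r. f i) = (\<Prod>i = 1..h. f i) * (\<Prod>i\<in>{h<..r}. f i)" for f :: "nat \<Rightarrow> rat"
proof -
  assume "h \<le> r"
  hence "{1..r} = {1..h} \<union> {h<..r}" by auto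
  moreover have "prod f ({1..h} \<union> {h<..r}) = prod f {1..h} * prod f {h<..r}"
    by (rule prod.union_disjoint) auto
  ultimately show ?thesis by (simp only:)
qed

text \<open>
Compare factorials with \<open>(2p)! / p!\<^sup>2\<close>. Passing from \<open>(2p)!\<close> to \<open>(2p - 2s - 1)!\<close> contributes odd
factors, which belong to the denominator, and even factors \<open>2 (p - i)\<close> with \<open>i \<le> s\<close>, which the
ratio of \<open>p!\<close> and \<open>(p - 2s - 1 - h)!\<close> cancels.
\<close>

lemma binomial_multiple_nonneg:
  assumes "h \<le> r"
  shows "binomial_multiple (axis_den r s) (\<lambda>p. of_nat ((2 * p - 2 * s - 1) choose (p + h)))"
  unfolding binomial_multiple_def
proof (intro exI eventually_sequentiallyI)
  (* The powers of two: 2 ^ (s + 1) from the even factors, against the 2 in 2 * binom(2p - 1, p). *)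
  let ?G = "smult (1 / 2 ^ s) ((\<Prod>i\<in>{s + 1..<2 * s + 1 + h}. [:- of_nat i, 1:]) * (\<Prod>i\<in>{h<..r}. [:of_nat i, 1:]))"
  fix p assume p: "2 * s + 1 + h \<le> p"
  define x :: rat where "x = of_nat p"
  define F :: rat where "F = of_nat ((2 * p - 2 * s - 1) choose (p + h))"
  define B :: rat where "B = of_nat ((2 * p - 1) choose p)"
  define ff where "ff k = (\<Prod>i<k. x - of_nat i)" for k
  define R where "R = (\<Prod>i = 1..h. x + of_nat i)"
  define S where "S = (\<Prod>j = 1..s. 2 * x + 1 - 2 * of_nat j)"
  define T where "T = (\<Prod>i\<in>{s + 1..<2 * s + 1 + h}. x - of_nat i)"
  define q where "q = p - (2 * s + 1 + h)"
  have M: "2 * p - 2 * s - 1 - (p + h) = q" "2 * p - 2 * s - 1 = 2 * p - (2 * s + 1)" "p + h \<le> 2 * p - 2 * s - 1"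
    using p by (simp_all add: q_def)
  have 1: "F * fact (p + h) * fact q = fact (2 * p - (2 * s + 1))"
  proof -
    have "fact (p + h) * fact q * ((2 * p - 2 * s - 1) choose (p + h)) = (fact (2 * p - 2 * s - 1) :: nat)"
      using binomial_fact_lemma[OF M(3)] unfolding M(1) .
    from this[THEN arg_cong[of _ _ "of_nat :: nat \<Rightarrow> rat"]] show ?thesis
      unfolding F_def M(2)[symmetric] by (simp only: of_nat_mult of_nat_fact mult_ac)
  qed
  have 2: "fact (p + h) = fact p * R" unfolding R_def x_def
    by (induction h) (simp_all add: algebra_simps)
  have 3: "fact p = fact q * ff (2 * s + 1 + h)"
    using fact_falling[of "2 * s + 1 + h" p] p by (simp add: q_def ff_def x_def)
  have 4: "2 * B * fact p * fact p = fact (2 * p)"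
    unfolding B_def by (rule central_binomial_fact) (use p in simp)
  have 5: "fact (2 * p) = fact (2 * p - (2 * s + 1)) * (2 ^ (s + 1) * ff (s + 1) * S)"
    using fact_falling[of "2 * s + 1" "2 * p"] falling_double[of x s] p
    by (simp add: ff_def S_def x_def)
  have 6: "ff (2 * s + 1 + h) = ff (s + 1) * T"
    unfolding ff_def T_def by (rule falling_split) simp
  have nz: "ff (s + 1) \<noteq> 0" "(fact p :: rat) \<noteq> 0" "(fact q :: rat) \<noteq> 0"
    using p by (auto simp: ff_def x_def)
  have "(fact p * fact q * ff (s + 1)) * (2 * B * T) = 2 * B * fact p * (fact q * (ff (s + 1) * T))"
    by (simp add: mult_ac)
  also have "\<dots> = 2 * B * fact p * fact p" by (simp only: 3 6)
  also have "\<dots> = (fact p * fact q * ff (s + 1)) * (F * R * 2 ^ (s + 1) * S)"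
    unfolding 4 5 1[symmetric] 2 by (simp add: mult_ac)
  finally have "2 * B * T = F * R * 2 ^ (s + 1) * S"
    using nz by simp
  hence FRS: "F * (R * S) = B * (T / 2 ^ s)"
    by (simp add: field_simps)
  have "F * poly (axis_den r s) x = F * (R * S) * (\<Prod>i\<in>{h<..r}. x + of_nat i)"
    unfolding poly_axis_den R_def S_def prod_split_upper[OF assms] by (simp add: mult_ac)
  also have "\<dots> = B * poly ?G x"
    unfolding FRS by (simp add: poly_prod T_def algebra_simps)
  finally show "of_nat ((2 * p - 2 * s - 1) choose (p + h)) * poly (axis_den r s) (of_nat p) =
    of_nat ((2 * p - 1) choose p) * poly ?G (of_nat p)"
    by (simp only: F_def B_def x_def)
qed

lemma binomial_multiple_neg:
  assumes "t \<le> s"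
  shows "binomial_multiple (axis_den r s) (\<lambda>p. of_nat ((2 * p - 2 * s - 1) choose (p - t)))"
  unfolding binomial_multiple_def
proof (intro exI eventually_sequentiallyI)
  let ?G = "smult (1 / 2 ^ s) ((\<Prod>i<t. [:- of_nat i, 1:]) * (\<Prod>i\<in>{s + 1..<2 * s + 1 - t}. [:- of_nat i, 1:]) *
    (\<Prod>i = 1..r. [:of_nat i, 1:]))"
  fix p assume p: "2 * s + 1 \<le> p"
  define x :: rat where "x = of_nat p"
  define F :: rat where "F = of_nat ((2 * p - 2 * s - 1) choose (p - t))"
  define B :: rat where "B = of_nat ((2 * p - 1) choose p)"
  define ff where "ff k = (\<Prod>i<k. x - of_nat i)" for k
  define S where "S = (\<Prod>j = 1..s. 2 * x + 1 - 2 * of_nat j)"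
  define T where "T = (\<Prod>i\<in>{s + 1..<2 * s + 1 - t}. x - of_nat i)"
  define q where "q = p - (2 * s + 1 - t)"
  have M: "2 * p - 2 * s - 1 - (p - t) = q" "2 * p - 2 * s - 1 = 2 * p - (2 * s + 1)" "p - t \<le> 2 * p - 2 * s - 1"
    using p assms by (simp_all add: q_def)
  have 1: "F * fact (p - t) * fact q = fact (2 * p - (2 * s + 1))"
  proof -
    have "fact (p - t) * fact q * ((2 * p - 2 * s - 1) choose (p - t)) = (fact (2 * p - 2 * s - 1) :: nat)"
      using binomial_fact_lemma[OF M(3)] unfolding M(1) .
    from this[THEN arg_cong[of _ _ "of_nat :: nat \<Rightarrow> rat"]] show ?thesis
      unfolding F_def M(2)[symmetric] by (simp only: of_nat_mult of_nat_fact mult_ac)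
  qed
  have 2: "fact p = fact (p - t) * ff t"
    using fact_falling[of t p] p assms by (simp add: ff_def x_def)
  have 3: "fact p = fact q * ff (2 * s + 1 - t)"
    using fact_falling[of "2 * s + 1 - t" p] p by (simp add: q_def ff_def x_def)
  have 4: "2 * B * fact p * fact p = fact (2 * p)"
    unfolding B_def by (rule central_binomial_fact) (use p in simp)
  have 5: "fact (2 * p) = fact (2 * p - (2 * s + 1)) * (2 ^ (s + 1) * ff (s + 1) * S)"
    using fact_falling[of "2 * s + 1" "2 * p"] falling_double[of x s] p
    by (simp add: ff_def S_def x_def)
  have 6: "ff (2 * s + 1 - t) = ff (s + 1) * T"
    unfolding ff_def T_def by (rule falling_split) (use assms in simp)
  have nz: "ff (s + 1) \<noteq> 0" "(fact (p - t) :: rat) \<noteq> 0" "(fact q :: rat) \<noteq> 0"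
    using p by (auto simp: ff_def x_def)
  have "(fact (p - t) * fact q * ff (s + 1)) * (2 * B * (ff t * T)) =
    2 * B * (fact (p - t) * ff t) * (fact q * (ff (s + 1) * T))"
    by (simp add: mult_ac)
  also have "\<dots> = 2 * B * fact p * fact p" by (simp only: 2[symmetric] 3[symmetric] 6[symmetric])
  also have "\<dots> = (fact (p - t) * fact q * ff (s + 1)) * (F * 2 ^ (s + 1) * S)"
    unfolding 4 5 1[symmetric] by (simp add: mult_ac)
  finally have "2 * B * (ff t * T) = F * 2 ^ (s + 1) * S"
    using nz by simp
  hence FS: "F * S = B * (ff t * T / 2 ^ s)"
    by (simp add: field_simps)
  have "F * poly (axis_den r s) x = F * S * (\<Prod>i = 1..r. x + of_nat i)"
    unfolding poly_axis_den S_def by (simp add: mult_ac)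
  also have "\<dots> = B * poly ?G x"
    unfolding FS by (simp add: poly_prod T_def ff_def algebra_simps)
  finally show "of_nat ((2 * p - 2 * s - 1) choose (p - t)) * poly (axis_den r s) (of_nat p) =
    of_nat ((2 * p - 1) choose p) * poly ?G (of_nat p)"
    by (simp only: F_def B_def x_def)
qed

lemma binomial_multiple_upper:
  fixes h :: int
  assumes "h \<le> int r" "- int s \<le> h"
  shows "binomial_multiple (axis_den r s) (\<lambda>p. of_nat ((2 * p - 2 * s - 1) choose nat (int p + h)))"
proof (cases "0 \<le> h")
  case True
  have "nat (int p + h) = p + nat h" for p using True by simp
  thus ?thesis using binomial_multiple_nonneg[of "nat h" r s] True assms by simp
next
  case False
  have "nat (int p + h) = p - nat (- h)" for p using False by simp
  thus ?thesis using binomial_multiple_neg[of "nat (- h)" s r] False assms by simp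
qed

text \<open>
By symmetry the larger of the two lower indices can be taken as \<open>p + h\<close>; both shifts are bounded by
\<open>r\<close> because either may be the larger one.
\<close>

lemma binomial_multiple_near_central:
  fixes h :: int
  assumes "h \<le> int r" "- 2 * int s - 1 - h \<le> int r"
  shows "binomial_multiple (axis_den r s) (\<lambda>p. of_nat ((2 * p - 2 * s - 1) choose nat (int p + h)))"
proof (cases "- int s \<le> h")
  case True
  thus ?thesis using binomial_multiple_upper assms by blast
next
  case False
  define g where "g = - 2 * int s - 1 - h"
  have "binomial_multiple (axis_den r s) (\<lambda>p. of_nat ((2 * p - 2 * s - 1) choose nat (int p + g)))"
    by (rule binomial_multiple_upper) (use assms False in \<open>auto simp: g_def\<close>)
  moreover have "\<forall>\<^sub>F p in sequentially. (of_nat ((2 * p - 2 * s - 1) choose nat (int p + h)) :: rat) =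
    of_nat ((2 * p - 2 * s - 1) choose nat (int p + g))"
  proof (rule eventually_sequentiallyI)
    fix p assume p: "2 * s + 1 + nat (- h) \<le> p"
    have le: "nat (int p + h) \<le> 2 * p - 2 * s - 1" using p False by linarith
    have "2 * p - 2 * s - 1 - nat (int p + h) = nat (int p + g)"
      using p False by (simp add: g_def nat_diff_distrib'[symmetric] of_nat_diff)
    with binomial_symmetric[OF le]
    show "(of_nat ((2 * p - 2 * s - 1) choose nat (int p + h)) :: rat) =
      of_nat ((2 * p - 2 * s - 1) choose nat (int p + g))" by simp
  qed
  ultimately show ?thesis by (rule binomial_multiple_cong)
qed

lemma coeff_one_minus_square:
  "coeff ([:1, 0, - 1:] ^ M :: int poly) m = (if even m then (- 1) ^ (m div 2) * int (M choose (m div 2)) else 0)"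
proof (induction M arbitrary: m)
  case 0
  show ?case by (cases m) (auto simp: binomial_eq_0)
next
  case (Suc M)
  have c: "coeff ([:1, 0, - 1:] * P) m = coeff P m - (if m < 2 then 0 else coeff P (m - 2))" for P :: "int poly" and m
  proof -
    have "[:1, 0, - 1:] * P = P - pCons 0 (pCons 0 P)" by simp
    thus ?thesis by (cases m; cases "m - 1") (auto simp: coeff_pCons split: nat.splits)
  qed
  show ?case
  proof (cases "m < 2")
    case True
    hence "m = 0 \<or> m = 1" by auto
    thus ?thesis by (auto simp: c Suc power_Suc)
  next
    case False
    define k where "k = m - 2"
    have m: "m = Suc (Suc k)" using False by (simp add: k_def)
    show ?thesis unfolding power_Suc c Suc by (simp add: m algebra_simps)
  qed
qed

text \<open>
The generating polynomial is split as \<open>(1 - z\<^sup>2)\<^bsup>M\<^esup>\<close> times a factor of bounded degree.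
\<close>

lemma krawtchouk_expand:
  assumes "a = M + a'" "b = M + b'" "a' + b' \<le> x"
  shows "krawtchouk a b x = (\<Sum>i\<le>a' + b'. coeff ([:1, 1:] ^ a' * [:1, - 1:] ^ b') i *
    (if even (x - i) then (- 1) ^ ((x - i) div 2) * int (M choose ((x - i) div 2)) else 0))"
proof -
  define q where "q = ([:1, 1:] ^ a' * [:1, - 1:] ^ b' :: int poly)"
  have deg: "degree q \<le> a' + b'"
    unfolding q_def by (simp add: degree_mult_eq degree_power_eq)
  have "[:1, 1:] ^ a * [:1, - 1:] ^ b = q * ([:1, 1:] * [:1, - 1:]) ^ M"
    unfolding q_def assms(1,2) power_add power_mult_distrib by (simp only: mult_ac)
  also have "[:1, 1:] * [:1, - 1:] = ([:1, 0, - 1:] :: int poly)" by simp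
  finally have "krawtchouk a b x = (\<Sum>i\<le>x. coeff q i * coeff ([:1, 0, - 1:] ^ M) (x - i))"
    by (simp only: krawtchouk_def coeff_mult)
  also have "\<dots> = (\<Sum>i\<le>a' + b'. coeff q i * coeff ([:1, 0, - 1:] ^ M) (x - i))"
    by (rule sum.mono_neutral_right) (use assms(3) deg in \<open>auto simp: coeff_eq_0\<close>)
  finally show ?thesis unfolding coeff_one_minus_square q_def .
qed

text \<open>
The exponent \<open>2p - 2s - 1\<close> is extracted from both factors. The bound on \<open>\<xi>\<close> limits the largest lower
index of the binomial coefficients that occur, and the bound on \<open>\<zeta> + \<eta> - \<xi>\<close> limits the largest
complementary index. The sign \<open>(-1)\<^bsup>p\<^esup>\<close> comes from \<open>1 - z\<^sup>2\<close>; it disappears in products of two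
Krawtchouk numbers.
\<close>

lemma krawtchouk_multiple:
  fixes \<xi> \<eta> \<zeta> :: int
  assumes "- 2 * int s - 1 \<le> \<zeta>" "- 2 * int s - 1 \<le> \<eta>" "\<xi> \<le> 2 * int r + 1" "\<zeta> + \<eta> - \<xi> \<le> 2 * int r + 1"
  shows "binomial_multiple (axis_den r s) (\<lambda>p. (- 1) ^ p * of_int (krawtchouk
    (nat (2 * int p + \<zeta>)) (nat (2 * int p + \<eta>)) (nat (2 * int p + \<xi>))))"
proof -
  define a' where "a' = nat (\<zeta> + 2 * int s + 1)"
  define b' where "b' = nat (\<eta> + 2 * int s + 1)"
  define q where "q = ([:1, 1:] ^ a' * [:1, - 1:] ^ b' :: int poly)"
  (* The i-th term of the expansion contains the binomial coefficient with lower index p + h i. *)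
  define h where "h i = (\<xi> - int i) div 2" for i
  define c where "c i = (if even (\<xi> - int i) then of_int (coeff q i) * (if even (h i) then 1 else - 1) else (0 :: rat))" for i
  have "binomial_multiple (axis_den r s) (\<lambda>p. \<Sum>i\<in>{..a' + b'}. c i * of_nat ((2 * p - 2 * s - 1) choose nat (int p + h i)))"
  proof (rule binomial_multiple_sum)
    fix i assume i: "i \<in> {..a' + b'}"
    show "binomial_multiple (axis_den r s) (\<lambda>p. c i * of_nat ((2 * p - 2 * s - 1) choose nat (int p + h i)))"
    proof (cases "even (\<xi> - int i)")
      case True
      hence h2: "2 * h i = \<xi> - int i" unfolding h_def by simp
      show ?thesis
      proof (rule binomial_multiple_scale, rule binomial_multiple_near_central)
        show "h i \<le> int r" using h2 assms(3) by linarith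
        have "int i \<le> \<zeta> + \<eta> + 4 * int s + 2" using i assms(1,2) by (simp add: a'_def b'_def)
        thus "- 2 * int s - 1 - h i \<le> int r" using h2 assms(4) by linarith
      qed
    qed (simp add: c_def binomial_multiple_0)
  qed
  thus ?thesis
  proof (rule binomial_multiple_cong, intro eventually_sequentiallyI)
    fix p assume "2 * s + 1 + a' + b' + nat \<bar>\<xi>\<bar> + nat \<bar>\<zeta>\<bar> + nat \<bar>\<eta>\<bar> \<le> p"
    hence p: "2 * int s + 1 + int a' + int b' + \<bar>\<xi>\<bar> + \<bar>\<zeta>\<bar> + \<bar>\<eta>\<bar> \<le> int p" by linarith
    define M where "M = 2 * p - 2 * s - 1"
    have M: "int M = 2 * int p - 2 * int s - 1" using p by (simp add: M_def of_nat_diff)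
    have e: "nat (2 * int p + \<zeta>) = M + a'" "nat (2 * int p + \<eta>) = M + b'"
      using M p assms(1,2) by (simp_all add: a'_def b'_def)
    have x: "a' + b' \<le> nat (2 * int p + \<xi>)" using p by linarith
    have sgn: "(- 1) ^ p * (- 1) ^ nat (int p + k) = (if even k then 1 else - 1 :: rat)" if "0 \<le> int p + k" for k
    proof -
      have "even (p + nat (int p + k)) \<longleftrightarrow> even k" using that by (auto simp: even_nat_iff)
      thus ?thesis by (auto simp: uminus_power_if simp flip: power_add)
    qed
    have "(- 1) ^ p * of_int (krawtchouk (nat (2 * int p + \<zeta>)) (nat (2 * int p + \<eta>)) (nat (2 * int p + \<xi>))) =
      (\<Sum>i\<le>a' + b'. (- 1) ^ p * (of_int (coeff q i) *
        (if even (nat (2 * int p + \<xi>) - i) then (- 1) ^ ((nat (2 * int p + \<xi>) - i) div 2) *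
          of_nat (M choose ((nat (2 * int p + \<xi>) - i) div 2)) else 0)) :: rat)"
      unfolding krawtchouk_expand[OF e x] q_def of_int_sum sum_distrib_left
      by (intro sum.cong refl) simp
    also have "\<dots> = (\<Sum>i\<le>a' + b'. c i * of_nat (M choose nat (int p + h i)))"
    proof (rule sum.cong[OF refl])
      fix i assume "i \<in> {..a' + b'}"
      hence i: "int i \<le> int a' + int b'" by simp
      have ev: "even (nat (2 * int p + \<xi>) - i) \<longleftrightarrow> even (\<xi> - int i)"
      proof -
        have "int (nat (2 * int p + \<xi>) - i) = 2 * int p + (\<xi> - int i)" using i p by (simp add: of_nat_diff)
        hence "even (int (nat (2 * int p + \<xi>) - i)) \<longleftrightarrow> even (\<xi> - int i)" by simp
        thus ?thesis by simp
      qed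
      show "(- 1) ^ p * (of_int (coeff q i) *
        (if even (nat (2 * int p + \<xi>) - i) then (- 1) ^ ((nat (2 * int p + \<xi>) - i) div 2) *
          of_nat (M choose ((nat (2 * int p + \<xi>) - i) div 2)) else 0)) = c i * of_nat (M choose nat (int p + h i))"
      proof (cases "even (\<xi> - int i)")
        case True
        hence h2: "2 * h i = \<xi> - int i" unfolding h_def by simp
        have nn: "0 \<le> int p + h i" using h2 i p by linarith
        have d: "(nat (2 * int p + \<xi>) - i) div 2 = nat (int p + h i)"
        proof -
          have "int (nat (2 * int p + \<xi>) - i) = 2 * (int p + h i)" using i p h2 by (simp add: of_nat_diff)
          hence "int (nat (2 * int p + \<xi>) - i) = int (2 * nat (int p + h i))" using nn by simp
          hence "nat (2 * int p + \<xi>) - i = 2 * nat (int p + h i)" by (simp only: of_nat_eq_iff)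
          thus ?thesis by simp
        qed
        have "c i = of_int (coeff q i) * ((- 1) ^ p * (- 1) ^ nat (int p + h i))"
          unfolding sgn[OF nn] c_def using True by simp
        thus ?thesis using True unfolding ev d by (simp add: mult_ac)
      next
        case False
        thus ?thesis unfolding ev by (simp add: c_def)
      qed
    qed
    finally show "(- 1) ^ p * of_int (krawtchouk (nat (2 * int p + \<zeta>)) (nat (2 * int p + \<eta>)) (nat (2 * int p + \<xi>))) =
      (\<Sum>i\<in>{..a' + b'}. c i * of_nat ((2 * p - 2 * s - 1) choose nat (int p + h i)))"
      by (simp only: M_def)
  qed
qed

text \<open>
The functions of \<open>p\<close> that eventually equal \<open>2\<^bsup>-4p\<^esup> binom(2p - 1, p)\<^sup>2\<close> times a rational function with
denominator \<open>C\<close>.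
\<close>

definition axis_multiple :: "rat poly \<Rightarrow> (nat \<Rightarrow> real) \<Rightarrow> bool" where
  "axis_multiple C F \<longleftrightarrow> (\<exists>G. \<forall>\<^sub>F p in sequentially. F p * of_rat (poly C (of_nat p)) =
     (real ((2 * p - 1) choose p))\<^sup>2 / 2 ^ (4 * p) * of_rat (poly G (of_nat p)))"

lemma axis_multiple_add:
  assumes "axis_multiple d F" "axis_multiple d F'"
  shows "axis_multiple d (\<lambda>p. F p + F' p)"
proof -
  obtain G G' where
    "\<forall>\<^sub>F p in sequentially. F p * of_rat (poly d (of_nat p)) = (real ((2 * p - 1) choose p))\<^sup>2 / 2 ^ (4 * p) * of_rat (poly G (of_nat p))"
    "\<forall>\<^sub>F p in sequentially. F' p * of_rat (poly d (of_nat p)) = (real ((2 * p - 1) choose p))\<^sup>2 / 2 ^ (4 * p) * of_rat (poly G' (of_nat p))"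
    using assms unfolding axis_multiple_def by blast
  hence "\<forall>\<^sub>F p in sequentially. (F p + F' p) * of_rat (poly d (of_nat p)) =
     (real ((2 * p - 1) choose p))\<^sup>2 / 2 ^ (4 * p) * of_rat (poly (G + G') (of_nat p))"
    by eventually_elim (simp only: distrib_left distrib_right poly_add of_rat_add)
  thus ?thesis unfolding axis_multiple_def by blast
qed

lemma axis_multiple_scale:
  assumes "axis_multiple d F"
  shows "axis_multiple d (\<lambda>p. of_rat c * F p)"
proof -
  obtain G where
    "\<forall>\<^sub>F p in sequentially. F p * of_rat (poly d (of_nat p)) = (real ((2 * p - 1) choose p))\<^sup>2 / 2 ^ (4 * p) * of_rat (poly G (of_nat p))"
    using assms unfolding axis_multiple_def by blast
  hence "\<forall>\<^sub>F p in sequentially. (of_rat c * F p) * of_rat (poly d (of_nat p)) =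
     (real ((2 * p - 1) choose p))\<^sup>2 / 2 ^ (4 * p) * of_rat (poly (smult c G) (of_nat p))"
    by eventually_elim (simp only: mult.assoc mult.left_commute poly_smult of_rat_mult)
  thus ?thesis unfolding axis_multiple_def by blast
qed

lemma axis_multiple_sum:
  assumes "\<And>i. i \<in> I \<Longrightarrow> axis_multiple d (F i)"
  shows "axis_multiple d (\<lambda>p. \<Sum>i\<in>I. F i p)"
proof -
  have 0: "axis_multiple d (\<lambda>p. 0)"
    unfolding axis_multiple_def by (rule exI[of _ 0]) simp
  show ?thesis using assms
    by (induction I rule: infinite_finite_induct) (auto simp: 0 intro!: axis_multiple_add)
qed

lemma creation_multiple:
  fixes \<xi> \<eta> \<zeta> \<omega> :: int
  assumes "\<xi> + \<omega> = \<eta> + \<zeta>"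
    and lower: "- 2 * int s - 1 \<le> \<xi>" "- 2 * int s - 1 \<le> \<eta>" "- 2 * int s - 1 \<le> \<zeta>" "- 2 * int s - 1 \<le> \<omega>"
    and upper: "\<xi> \<le> 2 * int r + 1" "\<eta> \<le> 2 * int r + 1" "\<zeta> \<le> 2 * int r + 1" "\<omega> \<le> 2 * int r + 1"
    and F: "\<forall>\<^sub>F p in sequentially. F p = creation (nat (4 * int p + \<xi> + \<omega> + 1)) (\<xi> - \<zeta>) (\<xi> - \<eta>)"
  shows "axis_multiple ((axis_den r s)\<^sup>2) F"
proof -
  let ?d = "\<lambda>p. poly (axis_den r s) (of_nat p)"
  let ?B = "\<lambda>p. of_nat ((2 * p - 1) choose p)"
  define k1 where "k1 p = krawtchouk (nat (2 * int p + \<zeta>)) (nat (2 * int p + \<eta>)) (nat (2 * int p + \<xi>))" for p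
  define k2 where "k2 p = krawtchouk (nat (2 * int p + \<omega>)) (nat (2 * int p + \<xi>)) (nat (2 * int p + \<eta>))" for p
  have "binomial_multiple (axis_den r s) (\<lambda>p. (- 1) ^ p * of_int (k1 p))"
    unfolding k1_def by (rule krawtchouk_multiple) (use assms in linarith)+
  then obtain G1 where G1: "\<forall>\<^sub>F p in sequentially. (- 1) ^ p * of_int (k1 p) * ?d p = ?B p * poly G1 (of_nat p)"
    unfolding binomial_multiple_def by blast
  have "binomial_multiple (axis_den r s) (\<lambda>p. (- 1) ^ p * of_int (k2 p))"
    unfolding k2_def by (rule krawtchouk_multiple) (use assms in linarith)+
  then obtain G2 where G2: "\<forall>\<^sub>F p in sequentially. (- 1) ^ p * of_int (k2 p) * ?d p = ?B p * poly G2 (of_nat p)"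
    unfolding binomial_multiple_def by blast
  define e :: rat where "e = 2 powi (- (\<xi> + \<omega>))"
  have "\<forall>\<^sub>F p in sequentially. F p * of_rat (poly ((axis_den r s)\<^sup>2) (of_nat p)) =
     (real ((2 * p - 1) choose p))\<^sup>2 / 2 ^ (4 * p) * of_rat (poly (smult e (G1 * G2)) (of_nat p))"
    using G1 G2 F eventually_ge_at_top[of "nat (\<bar>\<xi>\<bar> + \<bar>\<eta>\<bar> + \<bar>\<zeta>\<bar> + \<bar>\<omega>\<bar>)"]
  proof eventually_elim
    case (elim p)
    define x x' y y' where xy: "x = nat (2 * int p + \<xi>)" "x' = nat (2 * int p + \<omega>)"
      "y = nat (2 * int p + \<eta>)" "y' = nat (2 * int p + \<zeta>)"
    have p: "\<bar>\<xi>\<bar> + \<bar>\<eta>\<bar> + \<bar>\<zeta>\<bar> + \<bar>\<omega>\<bar> \<le> int p" using elim(4) by linarith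
    have ixy: "int x = 2 * int p + \<xi>" "int x' = 2 * int p + \<omega>" "int y = 2 * int p + \<eta>" "int y' = 2 * int p + \<zeta>"
      using p by (simp_all add: xy)
    have N: "x + x' = y + y'" using ixy assms(1) by linarith
    have "nat (4 * int p + \<xi> + \<omega> + 1) = Suc (x + x')" using ixy p by linarith
    moreover have "\<xi> - \<zeta> = int x - int y'" "\<xi> - \<eta> = int x - int y" using ixy by simp_all
    ultimately have "F p = real_of_int (krawtchouk y' y x * krawtchouk x' x y) / 2 ^ (x + x')"
      using creation_krawtchouk[OF refl N[symmetric]] elim(3) by simp
    hence Fp: "F p = of_rat (of_int (k1 p) * of_int (k2 p)) / 2 ^ (x + x')"
      by (simp add: k1_def k2_def xy of_rat_mult)
    have "2 ^ (x + x') = (2 :: rat) powi (int (x + x'))" by (simp only: power_int_of_nat)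
    also have "int (x + x') = int (4 * p) - (- (\<xi> + \<omega>))" using ixy by simp
    also have "2 powi \<dots> = (2 :: rat) powi int (4 * p) / 2 powi (- (\<xi> + \<omega>))" by (rule power_int_diff) simp
    also have "\<dots> = (2 :: rat) ^ (4 * p) / e" by (simp only: power_int_of_nat e_def)
    finally have pow: "2 ^ (x + x') = (2 :: rat) ^ (4 * p) / e" .
    have e: "e \<noteq> 0" by (simp add: e_def)
    have "(- 1) ^ p * (- 1) ^ p = (1 :: rat)" by (simp flip: power_mult_distrib)
    hence "of_int (k1 p) * of_int (k2 p) * (?d p)\<^sup>2 = ((- 1) ^ p * (- 1) ^ p) * (of_int (k1 p) * of_int (k2 p) * (?d p)\<^sup>2)"
      by simp
    also have "\<dots> = ((- 1) ^ p * of_int (k1 p) * ?d p) * ((- 1) ^ p * of_int (k2 p) * ?d p)"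
      by (simp only: power2_eq_square mult_ac)
    also have "\<dots> = (?B p)\<^sup>2 * poly (G1 * G2) (of_nat p)"
      unfolding elim(1,2) by (simp add: power2_eq_square mult_ac)
    finally have key: "of_int (k1 p) * of_int (k2 p) * (?d p)\<^sup>2 = (?B p)\<^sup>2 * poly (G1 * G2) (of_nat p)" .
    have "F p * of_rat (poly ((axis_den r s)\<^sup>2) (of_nat p)) =
      of_rat (of_int (k1 p) * of_int (k2 p) * (?d p)\<^sup>2 / 2 ^ (x + x'))"
      unfolding Fp by (simp add: of_rat_mult of_rat_divide of_rat_power poly_power)
    also have "of_int (k1 p) * of_int (k2 p) * (?d p)\<^sup>2 / 2 ^ (x + x') =
      (?B p)\<^sup>2 / 2 ^ (4 * p) * poly (smult e (G1 * G2)) (of_nat p)"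
      unfolding key pow using e by (simp add: field_simps)
    finally show ?case by (simp add: of_rat_mult of_rat_divide of_rat_power)
  qed
  thus ?thesis unfolding axis_multiple_def by blast
qed

lemma top_prob_reflect:
  "odd (i + j + int n) \<Longrightarrow> top_prob n (- i) j = top_prob n i j"
proof (induction n arbitrary: j)
  case 0
  have "domino_probability 0 (horizontal_domino a b) = 0" for a b
  proof -
    have "(a, b) \<notin> aztec_diamond 0" unfolding mem_aztec by presburger
    thus ?thesis by (simp add: domino_probability_outside horizontal_domino_def)
  qed
  thus ?case by (simp add: top_prob_def)
next
  case (Suc n)
  have T: "top_prob (Suc n) a b = top_prob n a (b - 1) + creation (Suc n) a b / 2"
    if "odd (a + b + int (Suc n))" for a b
    using side_prob_Suc(1)[OF that] by (simp add: top_prob_def bottom_prob_def)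
  have o: "odd (- i + j + int (Suc n))" "odd (i + (j - 1) + int n)" using Suc.prems by presburger+
  show ?case unfolding T[OF o(1)] T[OF Suc.prems] using Suc.IH[OF o(2)] creation_neg[of "Suc n" i j] by simp
qed

lemma domino_prob_top_prob:
  assumes "odd (l + int n)"
  shows "domino_prob l 0 n = top_prob n l 0"
proof -
  have "black n (l - 1, 0)"
    using assms unfolding black_def cong_def by simp presburger
  thus ?thesis
    unfolding domino_prob_def top_prob_def domino_probability_def
    using tilings_nonempty[of n] by (simp add: measure_pmf_of_set Int_def)
qed

text \<open>
All shifts in the creation rates of \<open>top_prob_axis\<close> lie between \<open>\<alpha> - 1 - a\<close> and \<open>a\<close>.
\<close>

lemma axis_probability_multiple:
  assumes \<alpha>: "odd (L + \<alpha>)" and a: "2 * a = int L + int \<alpha> - 1"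
    and lower: "- 2 * int s - 1 \<le> int \<alpha> - 1 - a" and upper: "a \<le> 2 * int r + 1"
  shows "axis_multiple ((axis_den r s)\<^sup>2) (\<lambda>p. top_prob (4 * p + \<alpha>) (int L) 0 - 1 / 4)"
proof -
  (* With i = int L and j = 0, the four distances from the sides are 2p + a (twice) and 2p + b (twice). *)
  define b where "b = int \<alpha> - 1 - a"
  have ab: "a - b = int L" "a + b = int \<alpha> - 1" using a by (simp_all add: b_def)
  have lo: "- 2 * int s - 1 \<le> b" using lower by (simp add: b_def)
  have large: "\<forall>\<^sub>F p in sequentially. L < p" by (rule eventually_gt_at_top)
  have t1: "axis_multiple ((axis_den r s)\<^sup>2) (\<lambda>p. creation (4 * p + \<alpha>) (int L) 0)"
  proof (rule creation_multiple[where \<xi> = a and \<eta> = a and \<zeta> = b and \<omega> = b])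
    show "\<forall>\<^sub>F p in sequentially. creation (4 * p + \<alpha>) (int L) 0 = creation (nat (4 * int p + a + b + 1)) (a - b) (a - a)"
      using large
    proof eventually_elim
      case (elim p)
      have "nat (4 * int p + a + b + 1) = 4 * p + \<alpha>" using ab by linarith
      thus ?case using ab by simp
    qed
  qed (use ab lo upper in linarith)+
  have t2: "axis_multiple ((axis_den r s)\<^sup>2) (\<lambda>p. creation (4 * p + \<alpha> - L) 0 0)"
  proof (rule creation_multiple[where \<xi> = b and \<eta> = b and \<zeta> = b and \<omega> = b])
    show "\<forall>\<^sub>F p in sequentially. creation (4 * p + \<alpha> - L) 0 0 = creation (nat (4 * int p + b + b + 1)) (b - b) (b - b)"
      using large
    proof eventually_elim
      case (elim p)
      have "nat (4 * int p + b + b + 1) = 4 * p + \<alpha> - L" using ab elim by linarith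
      thus ?case by simp
    qed
  qed (use ab lo upper in linarith)+
  have t3: "axis_multiple ((axis_den r s)\<^sup>2) (\<lambda>p. creation (4 * p + \<alpha> + L) 0 0)"
  proof (rule creation_multiple[where \<xi> = a and \<eta> = a and \<zeta> = a and \<omega> = a])
    show "\<forall>\<^sub>F p in sequentially. creation (4 * p + \<alpha> + L) 0 0 = creation (nat (4 * int p + a + a + 1)) (a - a) (a - a)"
      using large
    proof eventually_elim
      case (elim p)
      have "nat (4 * int p + a + a + 1) = 4 * p + \<alpha> + L" using ab elim by linarith
      thus ?case by simp
    qed
  qed (use ab lo upper in linarith)+
  have t4: "axis_multiple ((axis_den r s)\<^sup>2) (\<lambda>p. creation (4 * p + \<alpha> - L + t + 1) 0 (int t + 1))" if "t < L" for t
  proof (rule creation_multiple[where \<xi> = "b + int t + 1" and \<eta> = b and \<zeta> = "b + int t + 1" and \<omega> = b])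
    show "\<forall>\<^sub>F p in sequentially. creation (4 * p + \<alpha> - L + t + 1) 0 (int t + 1) =
      creation (nat (4 * int p + (b + int t + 1) + b + 1)) (b + int t + 1 - (b + int t + 1)) (b + int t + 1 - b)"
      using large
    proof eventually_elim
      case (elim p)
      have "nat (4 * int p + (b + int t + 1) + b + 1) = 4 * p + \<alpha> - L + t + 1" using ab elim by linarith
      thus ?case by simp
    qed
  qed (use ab lo upper that in linarith)+
  have t5: "axis_multiple ((axis_den r s)\<^sup>2) (\<lambda>p. creation (4 * p + \<alpha> + t + 1) 0 (int t + 1 - int L))" if "t < L" for t
  proof (rule creation_multiple[where \<xi> = "b + int t + 1" and \<eta> = a and \<zeta> = "b + int t + 1" and \<omega> = a])
    show "\<forall>\<^sub>F p in sequentially. creation (4 * p + \<alpha> + t + 1) 0 (int t + 1 - int L) =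
      creation (nat (4 * int p + (b + int t + 1) + a + 1)) (b + int t + 1 - (b + int t + 1)) (b + int t + 1 - a)"
      using large
    proof eventually_elim
      case (elim p)
      have n: "nat (4 * int p + (b + int t + 1) + a + 1) = 4 * p + \<alpha> + t + 1" using ab elim by linarith
      have j: "b + int t + 1 - a = int t + 1 - int L" using ab by simp
      show ?case unfolding n j by simp
    qed
  qed (use ab lo upper that in linarith)+
  have "axis_multiple ((axis_den r s)\<^sup>2) (\<lambda>p. of_rat (1 / 2) * creation (4 * p + \<alpha>) (int L) 0
    + of_rat (- 1 / 8) * creation (4 * p + \<alpha> - L) 0 0 + of_rat (- 1 / 8) * creation (4 * p + \<alpha> + L) 0 0
    + of_rat (- 1 / 4) * (\<Sum>t\<in>{..<L}. creation (4 * p + \<alpha> - L + t + 1) 0 (int t + 1))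
    + of_rat (1 / 4) * (\<Sum>t\<in>{..<L}. creation (4 * p + \<alpha> + t + 1) 0 (int t + 1 - int L)))"
    by (intro axis_multiple_add axis_multiple_scale axis_multiple_sum t1 t2 t3 t4 t5) auto
  then obtain G where G: "\<forall>\<^sub>F p in sequentially. (of_rat (1 / 2) * creation (4 * p + \<alpha>) (int L) 0
    + of_rat (- 1 / 8) * creation (4 * p + \<alpha> - L) 0 0 + of_rat (- 1 / 8) * creation (4 * p + \<alpha> + L) 0 0
    + of_rat (- 1 / 4) * (\<Sum>t\<in>{..<L}. creation (4 * p + \<alpha> - L + t + 1) 0 (int t + 1))
    + of_rat (1 / 4) * (\<Sum>t\<in>{..<L}. creation (4 * p + \<alpha> + t + 1) 0 (int t + 1 - int L))) *
      of_rat (poly ((axis_den r s)\<^sup>2) (of_nat p)) =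
     (real ((2 * p - 1) choose p))\<^sup>2 / 2 ^ (4 * p) * of_rat (poly G (of_nat p))"
    unfolding axis_multiple_def by blast
  have "\<forall>\<^sub>F p in sequentially. (top_prob (4 * p + \<alpha>) (int L) 0 - 1 / 4) * of_rat (poly ((axis_den r s)\<^sup>2) (of_nat p)) =
     (real ((2 * p - 1) choose p))\<^sup>2 / 2 ^ (4 * p) * of_rat (poly G (of_nat p))"
    using G large
  proof eventually_elim
    case (elim p)
    have odd: "odd (L + (4 * p + \<alpha>))" using \<alpha> by simp
    have c: "of_rat (1 / 2) = (1 / 2 :: real)" "of_rat (- 1 / 8) = (- 1 / 8 :: real)"
      "of_rat (- 1 / 4) = (- 1 / 4 :: real)" "of_rat (1 / 4) = (1 / 4 :: real)"
      by (simp_all add: of_rat_divide of_rat_minus)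
    have "top_prob (4 * p + \<alpha>) (int L) 0 - 1 / 4 = of_rat (1 / 2) * creation (4 * p + \<alpha>) (int L) 0
    + of_rat (- 1 / 8) * creation (4 * p + \<alpha> - L) 0 0 + of_rat (- 1 / 8) * creation (4 * p + \<alpha> + L) 0 0
    + of_rat (- 1 / 4) * (\<Sum>t\<in>{..<L}. creation (4 * p + \<alpha> - L + t + 1) 0 (int t + 1))
    + of_rat (1 / 4) * (\<Sum>t\<in>{..<L}. creation (4 * p + \<alpha> + t + 1) 0 (int t + 1 - int L))"
      unfolding c by (subst top_prob_axis[OF odd]) (use elim(2) in simp_all)
    with elim(1) show ?case by simp
  qed
  thus ?thesis unfolding axis_multiple_def by blast
qed

lemma C_poly_axis:
  "C_poly l 0 \<alpha> = (axis_den (r_idx \<alpha> ((l + int \<alpha> - 1) div 2)) (s_idx \<alpha> ((l + int \<alpha> - 1) div 2)))\<^sup>2"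
proof -
  have "N_poly r s r s = (axis_den r s)\<^sup>2" for r s
    unfolding N_poly_def axis_den_def power_mult_distrib prod_power_distrib
    by (intro arg_cong2[of _ _ _ _ "(*)"] prod.cong) auto
  thus ?thesis by (simp add: C_poly_def Let_def)
qed

text \<open>
For negative \<open>l\<close> the two cases in the definitions of \<open>r\<close> and \<open>s\<close> trade places, so that the bounds only
depend on \<open>\<bar>l\<bar>\<close>. Rounding down in the definitions costs at most \<open>1\<close>, which the bounds absorb.
\<close>

lemma idx_bounds:
  fixes l a :: int
  assumes "\<alpha> \<in> {0, 1, 2, 3}" "odd (l + int \<alpha>)" "2 * a = \<bar>l\<bar> + int \<alpha> - 1"
  shows "- 2 * int (s_idx \<alpha> ((l + int \<alpha> - 1) div 2)) - 1 \<le> int \<alpha> - 1 - a"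
    and "a \<le> 2 * int (r_idx \<alpha> ((l + int \<alpha> - 1) div 2)) + 1"
proof -
  define x where "x = (l + int \<alpha> - 1) div 2"
  have x: "2 * x = l + int \<alpha> - 1" using assms(2) unfolding x_def by simp
  have half: "2 * int (div2 z) + 1 \<ge> z" for z unfolding div2_def by linarith
  have al: "\<alpha> = 0 \<or> \<alpha> = 1 \<or> \<alpha> = 2 \<or> \<alpha> = 3" using assms(1) by simp
  have "- 2 * int (s_idx \<alpha> x) - 1 \<le> int \<alpha> - 1 - a \<and> a \<le> 2 * int (r_idx \<alpha> x) + 1"
  proof (cases "0 \<le> l")
    case True
    have ax: "a = x" using x assms(3) True by simp
    hence "0 \<le> x" using assms(3) by linarith
    have "int \<alpha> - 1 - a \<ge> - 2 * int (s_idx \<alpha> x) - 1"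
      using half[of "x - int \<alpha> + 1"] \<open>0 \<le> x\<close> ax by (simp add: s_idx_def)
    moreover have "a \<le> 2 * int (r_idx \<alpha> x) + 1"
      using half[of x] \<open>0 \<le> x\<close> ax by (auto simp: r_idx_def)
    ultimately show ?thesis by simp
  next
    case False
    have ax: "a = int \<alpha> - 1 - x" using x assms(3) False by simp
    have "x \<le> 0" proof -
      have "int \<alpha> \<le> 3" using al by auto
      thus ?thesis using x False by linarith
    qed
    have "int \<alpha> - 1 - a \<ge> - 2 * int (s_idx \<alpha> x) - 1"
      using half[of "\<bar>x\<bar>"] \<open>x \<le> 0\<close> ax by (auto simp: s_idx_def)
    moreover have "a \<le> 2 * int (r_idx \<alpha> x) + 1"
      using half[of "\<bar>x\<bar> + int \<alpha> - 1"] \<open>x \<le> 0\<close> ax by (simp add: r_idx_def)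
    ultimately show ?thesis by simp
  qed
  thus "- 2 * int (s_idx \<alpha> ((l + int \<alpha> - 1) div 2)) - 1 \<le> int \<alpha> - 1 - a"
    "a \<le> 2 * int (r_idx \<alpha> ((l + int \<alpha> - 1) div 2)) + 1"
    unfolding x_def by blast+
qed

lemma denominator_dvd:
  fixes G C :: "rat poly"
  assumes "C \<noteq> 0"
  shows "snd (quot_of_fract (Fract G C)) dvd C"
    and "fst (quot_of_fract (Fract G C)) * C = G * snd (quot_of_fract (Fract G C))"
proof -
  define a b where "a = fst (quot_of_fract (Fract G C))" and "b = snd (quot_of_fract (Fract G C))"
  have b: "b \<noteq> 0" by (simp add: b_def)
  have "Fract a b = Fract G C"
    using quot_to_fract_quot_of_fract[of "Fract G C"]
    by (simp add: quot_to_fract_def case_prod_unfold a_def b_def)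
  hence eq: "a * C = G * b" using b assms by (simp add: eq_fract)
  moreover have "coprime a b" unfolding a_def b_def by (rule coprime_quot_of_fract)
  ultimately show "snd (quot_of_fract (Fract G C)) dvd C"
    unfolding b_def[symmetric] by (metis coprime_commute coprime_dvd_mult_right_iff dvd_triv_right)
  show "fst (quot_of_fract (Fract G C)) * C = G * snd (quot_of_fract (Fract G C))"
    using eq by (simp add: a_def b_def)
qed

text \<open>
A representation with denominator \<open>C\<close> for large \<open>p\<close> exists for only one rational function, and
cancelling common factors leaves a divisor of \<open>C\<close>.
\<close>

lemma D_poly_dvd:
  assumes C: "C \<noteq> 0"
    and P: "\<forall>\<^sub>F p in sequentially. (domino_prob l m (4 * p + \<alpha>) - 1 / 4) * of_rat (poly C (of_nat p)) =
      (real ((2 * p - 1) choose p))\<^sup>2 / 2 ^ (4 * p + \<alpha>) * of_rat (poly G (of_nat p))"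
  shows "D_poly l m \<alpha> dvd C"
proof -
  define g where "g = Fract G C"
  define a b where ab: "a = fst (quot_of_fract g)" "b = snd (quot_of_fract g)"
  have dvd: "b dvd C" and eq: "a * C = G * b"
    using denominator_dvd[OF C, of G] by (simp_all add: ab g_def)
  have "finite (of_nat -` {x. poly C x = 0} :: nat set)"
    by (rule finite_vimageI) (use C in \<open>auto simp: poly_roots_finite inj_on_def\<close>)
  hence "\<forall>\<^sub>F p in sequentially. poly C (of_nat p) \<noteq> 0"
    by (simp add: cofinite_eq_sequentially[symmetric] eventually_cofinite vimage_def)
  with P have "represents_prob l m \<alpha> g"
    unfolding represents_prob_def
  proof eventually_elim
    case (elim p)
    have "poly b (of_nat p) \<noteq> 0" using elim(2) dvd by (auto elim!: dvdE)
    moreover have "poly a (of_nat p) * poly C (of_nat p) = poly G (of_nat p) * poly b (of_nat p)"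
      using eq by (metis poly_mult)
    ultimately have "ratfun_eval g (of_nat p) = poly G (of_nat p) / poly C (of_nat p)"
      using elim(2) by (simp add: ratfun_eval_def ab[symmetric] frac_eq_eq mult.commute)
    moreover have "domino_prob l m (4 * p + \<alpha>) - 1 / 4 =
      (real ((2 * p - 1) choose p))\<^sup>2 / 2 ^ (4 * p + \<alpha>) * of_rat (poly G (of_nat p)) / of_rat (poly C (of_nat p))"
      using elim by (simp add: eq_divide_eq mult_ac)
    ultimately show ?case by (simp add: of_rat_divide)
  qed
  hence "prob_ratfun l m \<alpha> = g"
    unfolding prob_ratfun_def using represents_prob_unique by blast
  thus ?thesis using dvd by (simp add: D_poly_def ab)
qed

theorem corollaryA15:
  fixes l :: int and \<alpha> :: nat
  assumes "\<alpha> \<in> {0, 1, 2, 3}" and "[l = int \<alpha> + 1] (mod 2)"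
  shows "D_poly l 0 \<alpha> dvd C_poly l 0 \<alpha>"
proof -
  define L where "L = nat \<bar>l\<bar>"
  have odd: "odd (l + int \<alpha>)" using assms(2) unfolding cong_def by presburger
  hence oddL: "odd (L + \<alpha>)" unfolding L_def by (simp add: even_nat_iff)
  define a where "a = (\<bar>l\<bar> + int \<alpha> - 1) div 2"
  have "even (\<bar>l\<bar> + int \<alpha> - 1)" using odd by simp
  hence a: "2 * a = \<bar>l\<bar> + int \<alpha> - 1" unfolding a_def by simp
  define r s where "r = r_idx \<alpha> ((l + int \<alpha> - 1) div 2)" and "s = s_idx \<alpha> ((l + int \<alpha> - 1) div 2)"
  have top: "domino_prob l 0 (4 * p + \<alpha>) = top_prob (4 * p + \<alpha>) (int L) 0" for p
  proof -
    have o: "odd (l + int (4 * p + \<alpha>))" "odd (l + 0 + int (4 * p + \<alpha>))" using odd by simp_all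
    show ?thesis
      using domino_prob_top_prob[OF o(1)] top_prob_reflect[OF o(2)] by (auto simp: L_def abs_if)
  qed
  have "axis_multiple ((axis_den r s)\<^sup>2) (\<lambda>p. top_prob (4 * p + \<alpha>) (int L) 0 - 1 / 4)"
    by (rule axis_probability_multiple[OF oddL, of a])
      (use a idx_bounds[OF assms(1) odd a] in \<open>simp_all add: L_def r_def s_def\<close>)
  then obtain G where G: "\<forall>\<^sub>F p in sequentially. (top_prob (4 * p + \<alpha>) (int L) 0 - 1 / 4) *
      of_rat (poly ((axis_den r s)\<^sup>2) (of_nat p)) =
      (real ((2 * p - 1) choose p))\<^sup>2 / 2 ^ (4 * p) * of_rat (poly G (of_nat p))"
    unfolding axis_multiple_def by blast
  have "axis_den r s \<noteq> 0"
    by (simp add: axis_den_def)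
  hence "(axis_den r s)\<^sup>2 \<noteq> 0" by simp
  moreover have "\<forall>\<^sub>F p in sequentially. (domino_prob l 0 (4 * p + \<alpha>) - 1 / 4) *
      of_rat (poly ((axis_den r s)\<^sup>2) (of_nat p)) =
      (real ((2 * p - 1) choose p))\<^sup>2 / 2 ^ (4 * p + \<alpha>) * of_rat (poly (smult (2 ^ \<alpha>) G) (of_nat p))"
    using G
  proof eventually_elim
    case (elim p)
    thus ?case unfolding top elim by (simp add: of_rat_mult of_rat_power power_add)
  qed
  ultimately have "D_poly l 0 \<alpha> dvd (axis_den r s)\<^sup>2" by (rule D_poly_dvd)
  thus ?thesis by (simp add: C_poly_axis r_def s_def)
qed

end
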